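(* Let $G$ be a three-dimensional unimodular Lie group with Lie algebra $\mathfrak g$, and let $(\lambda_1,\lambda_2,\lambda_3)$ be the normalized structure constants of $\mathfrak g$. Let $T$ be a left-invariant $(0,2)$ tensor field on $G$. There exists a pair $(g,c)$, where $g$ is a left-invariant Riemannian metric on $G$ and $c>0$ is a constant, such that $\mathrm{Ric}(g)=cT$, if and only if there is a basis $V_1,V_2,V_3$ of $\mathfrak g$ for which both of the following hold: (i) $[V_i,V_j]=\sum_{k=1}^3\epsilon_{ijk}\lambda_kV_k$ for all $i,j$, and $T$ is diagonal in this basis, say $T(V_i,V_j)=\delta^i_jT_i$; (ii) the diagonal components $T_1,T_2,T_3$ satisfy one of the following constraints, depending on $G$: - $G=SO(3)$, $(\lambda_1,\lambda_2,\lambda_3)=(2,2,2)$ (with the ordering convention $T_1\ge T_2\ge T_3$): either $T_1,T_2,T_3>0$; or $T_1>0$ and $T_2=T_3=0$; or $T_1>0$, $T_2<0$, $T_3<0$ and, with $\bar f(p)=2p^3+(T_1+T_2+T_3)p^2-T_1T_2T_3$, either [$\bar f\left(-\frac{T_1+T_2+T_3}{3}\right)\ge 0$ and $-\frac{T_1+T_2+T_3}{3}<0$] or $\bar f(-T_1)>0$. - $G=SL(2)$, $(\lambda_1,\lambda_2,\lambda_3)=(2,2,-2)$: either $T_1>0$, $T_2,T_3<0$ and $T_3+T_1>0$; or $T_2>0$, $T_1,T_3<0$ and $T_3+T_2>0$; or $T_1,T_2<0<T_3$ and $\max\{-T_1,-T_2\}<T_3$; or $T_1,T_2<0<T_3$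 and $\min\{-T_1,-T_2\}>T_3$; or $T_1,T_2<0<T_3$ and $T_3=-T_1=-T_2$; or $T_1<0$ and $T_2=T_3=0$; or $T_2<0$ and $T_1=T_3=0$. - $G=E(2)$, $(\lambda_1,\lambda_2,\lambda_3)=(2,2,0)$: either $T_1=T_2=T_3=0$; or $T_1>0$, $T_2,T_3<0$ and $T_1+T_2>0$; or $T_2>0$, $T_1,T_3<0$ and $T_1+T_2>0$. - $G=E(1,1)$, $(\lambda_1,\lambda_2,\lambda_3)=(2,-2,0)$: either $T_1=T_2=0$ and $T_3<0$; or $T_1>0$, $T_2,T_3<0$ and $T_1+T_2>0$; or $T_2>0$, $T_1,T_3<0$ and $T_1+T_2>0$. - $G=H_3$, $(\lambda_1,\lambda_2,\lambda_3)=(2,0,0)$: $T_1>0$, $T_2<0$, $T_3<0$. - $G=\mathbb R^3$, $(\lambda_1,\lambda_2,\lambda_3)=(0,0,0)$: $T_1=T_2=T_3=0$.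
   Context: Left-invariant tensor fields on $G$ are identified with tensors on $\mathfrak g$. $\mathrm{Ric}(g)$ is the Ricci curvature $(0,2)$-tensor of $g$, $\epsilon_{ijk}$ is the Levi-Civita symbol, and $\delta^i_j$ is the Kronecker symbol. By work of Milnor, the Lie algebra of any three-dimensional unimodular Lie group has a basis with $[V_i,V_j]=\sum_k\epsilon_{ijk}\lambda_kV_k$, where, after scaling and reordering, $(\lambda_1,\lambda_2,\lambda_3)$ is exactly one of $(2,2,2)$, $(2,2,-2)$, $(2,2,0)$, $(2,-2,0)$, $(2,0,0)$, $(0,0,0)$; this triple is called the normalized structure constants. The group $G$ is identified through its Lie algebra, and the corresponding names are $SO(3)$, $SL(2)$, the Euclidean group $E(2)$, the Minkowski group $E(1,1)$, the Heisenberg group $H_3$, and $\mathbb R^3$, respectively. "$T$ is diagonal in the basis $V_1,V_2,V_3$" means $T(V_i,V_j)=0$ for $i\ne j$. *)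

theory Defs
  imports "HOL-Analysis.Analysis"
begin

text \<open>
  A left-invariant vector field on a Lie group is determined by its value at the identity, and a
  left-invariant tensor field by its values on left-invariant vector fields.  Accordingly, a Lie
  group enters through its Lie algebra, a real vector space \<^typ>\<open>'a\<close> with a bracket, and left-invariant
  \<open>(0,2)\<close> tensor fields are the bilinear forms on \<^typ>\<open>'a\<close>.  No symmetry is assumed of such a form.
\<close>

definition lie_bracket :: "('a::real_vector \<Rightarrow> 'a \<Rightarrow> 'a) \<Rightarrow> bool" where
  "lie_bracket br \<longleftrightarrow> bilinear br \<and> (\<forall>x. br x x = 0) \<and>
     (\<forall>x y z. br x (br y z) + br y (br z x) + br z (br x y) = 0)"

text \<open>The choice of the basis is immaterial, see \<open>lin_trace_eq\<close> below.\<close>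

definition lin_trace :: "('a::real_vector \<Rightarrow> 'a) \<Rightarrow> real" where
  "lin_trace f =
     (let B = (SOME B. independent B \<and> span B = UNIV) in \<Sum>b\<in>B. representation B (f b) b)"

text \<open>
  For a connected Lie group, the Haar measure is bi-invariant if and only if \<open>ad x\<close> is traceless for
  every \<open>x\<close> in the Lie algebra.
\<close>

definition unimodular :: "('a::real_vector \<Rightarrow> 'a \<Rightarrow> 'a) \<Rightarrow> bool" where
  "unimodular br \<longleftrightarrow> (\<forall>x. lin_trace (br x) = 0)"

definition riemannian_metric :: "('a::real_vector \<Rightarrow> 'a \<Rightarrow> real) \<Rightarrow> bool" where
  "riemannian_metric g \<longleftrightarrow>
     bilinear g \<and> (\<forall>x y. g x y = g y x) \<and> (\<forall>x. x \<noteq> 0 \<longrightarrow> g x x > 0)"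

text \<open>
  The Levi-Civita connection \<open>D x y\<close> (the derivative of \<open>y\<close> in direction \<open>x\<close>) on left-invariant fields:
  it is torsion-free and metric.  In the metric condition \<open>X (g(Y,Z)) = g(D X Y, Z) + g(Y, D X Z)\<close>
  the left-hand side vanishes, because \<open>g(Y,Z)\<close> is a constant function when everything is left-invariant.
  Existence and uniqueness are \<open>is_levi_civita_ex1\<close> below.
\<close>

definition is_levi_civita ::
  "('a::real_vector \<Rightarrow> 'a \<Rightarrow> 'a) \<Rightarrow> ('a \<Rightarrow> 'a \<Rightarrow> real) \<Rightarrow> ('a \<Rightarrow> 'a \<Rightarrow> 'a) \<Rightarrow> bool" where
  "is_levi_civita br g D \<longleftrightarrow> bilinear D \<and> (\<forall>x y. D x y - D y x = br x y) \<and>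
     (\<forall>x y z. g (D x y) z + g y (D x z) = 0)"

definition levi_civita ::
  "('a::real_vector \<Rightarrow> 'a \<Rightarrow> 'a) \<Rightarrow> ('a \<Rightarrow> 'a \<Rightarrow> real) \<Rightarrow> 'a \<Rightarrow> 'a \<Rightarrow> 'a" where
  "levi_civita br g = (THE D. is_levi_civita br g D)"

definition curvature ::
  "('a::real_vector \<Rightarrow> 'a \<Rightarrow> 'a) \<Rightarrow> ('a \<Rightarrow> 'a \<Rightarrow> real) \<Rightarrow> 'a \<Rightarrow> 'a \<Rightarrow> 'a \<Rightarrow> 'a" where
  "curvature br g x y z =
     (let D = levi_civita br g in D x (D y z) - D y (D x z) - D (br x y) z)"

text \<open>Sign convention: the round sphere has positive Ricci curvature.\<close>

definition ricci ::
  "('a::real_vector \<Rightarrow> 'a \<Rightarrow> 'a) \<Rightarrow> ('a \<Rightarrow> 'a \<Rightarrow> real) \<Rightarrow> 'a \<Rightarrow> 'a \<Rightarrow> real" where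
  "ricci br g y z = lin_trace (\<lambda>x. curvature br g x y z)"

text \<open>In the index type \<^typ>\<open>3\<close> the elements are \<open>1\<close>, \<open>2\<close> and \<open>3 = 0\<close>.\<close>

definition levi_civita_symbol :: "3 \<Rightarrow> 3 \<Rightarrow> 3 \<Rightarrow> real" where
  "levi_civita_symbol i j k =
     (if (i, j, k) \<in> {(1, 2, 3), (2, 3, 1), (3, 1, 2)} then 1
      else if (i, j, k) \<in> {(1, 3, 2), (2, 1, 3), (3, 2, 1)} then - 1
      else 0)"

definition is_basis :: "(3 \<Rightarrow> 'a::real_vector) \<Rightarrow> bool" where
  "is_basis V \<longleftrightarrow> inj V \<and> independent (range V) \<and> span (range V) = UNIV"

definition milnor_basis ::
  "('a::real_vector \<Rightarrow> 'a \<Rightarrow> 'a) \<Rightarrow> real ^ 3 \<Rightarrow> (3 \<Rightarrow> 'a) \<Rightarrow> bool" where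
  "milnor_basis br l V \<longleftrightarrow> is_basis V \<and>
     (\<forall>i j. br (V i) (V j) = (\<Sum>k\<in>UNIV. (levi_civita_symbol i j k * l $ k) *\<^sub>R V k))"

definition normalized_structure_constants ::
  "('a::real_vector \<Rightarrow> 'a \<Rightarrow> 'a) \<Rightarrow> real ^ 3 \<Rightarrow> bool" where
  "normalized_structure_constants br l \<longleftrightarrow>
     l \<in> {vector [2, 2, 2], vector [2, 2, - 2], vector [2, 2, 0],
          vector [2, - 2, 0], vector [2, 0, 0], vector [0, 0, 0]} \<and>
     (\<exists>V. milnor_basis br l V)"

definition SO3_constraint :: "real \<Rightarrow> real \<Rightarrow> real \<Rightarrow> bool" where
  "SO3_constraint T1 T2 T3 \<longleftrightarrow>
     T1 \<ge> T2 \<and> T2 \<ge> T3 \<and>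
     (T1 > 0 \<and> T2 > 0 \<and> T3 > 0 \<or>
      T1 > 0 \<and> T2 = 0 \<and> T3 = 0 \<or>
      T1 > 0 \<and> T2 < 0 \<and> T3 < 0 \<and>
        (let f = (\<lambda>p. 2 * p ^ 3 + (T1 + T2 + T3) * p\<^sup>2 - T1 * T2 * T3) in
           f (- (T1 + T2 + T3) / 3) \<ge> 0 \<and> - (T1 + T2 + T3) / 3 < 0 \<or> f (- T1) > 0))"

definition SL2_constraint :: "real \<Rightarrow> real \<Rightarrow> real \<Rightarrow> bool" where
  "SL2_constraint T1 T2 T3 \<longleftrightarrow>
     T1 > 0 \<and> T2 < 0 \<and> T3 < 0 \<and> T3 + T1 > 0 \<or>
     T2 > 0 \<and> T1 < 0 \<and> T3 < 0 \<and> T3 + T2 > 0 \<or>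
     T1 < 0 \<and> T2 < 0 \<and> 0 < T3 \<and> max (- T1) (- T2) < T3 \<or>
     T1 < 0 \<and> T2 < 0 \<and> 0 < T3 \<and> min (- T1) (- T2) > T3 \<or>
     T1 < 0 \<and> T2 < 0 \<and> 0 < T3 \<and> T3 = - T1 \<and> T3 = - T2 \<or>
     T1 < 0 \<and> T2 = 0 \<and> T3 = 0 \<or>
     T2 < 0 \<and> T1 = 0 \<and> T3 = 0"

definition E2_constraint :: "real \<Rightarrow> real \<Rightarrow> real \<Rightarrow> bool" where
  "E2_constraint T1 T2 T3 \<longleftrightarrow>
     T1 = 0 \<and> T2 = 0 \<and> T3 = 0 \<or>
     T1 > 0 \<and> T2 < 0 \<and> T3 < 0 \<and> T1 + T2 > 0 \<or>
     T2 > 0 \<and> T1 < 0 \<and> T3 < 0 \<and> T1 + T2 > 0"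

definition E11_constraint :: "real \<Rightarrow> real \<Rightarrow> real \<Rightarrow> bool" where
  "E11_constraint T1 T2 T3 \<longleftrightarrow>
     T1 = 0 \<and> T2 = 0 \<and> T3 < 0 \<or>
     T1 > 0 \<and> T2 < 0 \<and> T3 < 0 \<and> T1 + T2 > 0 \<or>
     T2 > 0 \<and> T1 < 0 \<and> T3 < 0 \<and> T1 + T2 > 0"

definition H3_constraint :: "real \<Rightarrow> real \<Rightarrow> real \<Rightarrow> bool" where
  "H3_constraint T1 T2 T3 \<longleftrightarrow> T1 > 0 \<and> T2 < 0 \<and> T3 < 0"

definition R3_constraint :: "real \<Rightarrow> real \<Rightarrow> real \<Rightarrow> bool" where
  "R3_constraint T1 T2 T3 \<longleftrightarrow> T1 = 0 \<and> T2 = 0 \<and> T3 = 0"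

lemma lin_trace_eq:
  fixes f :: "'a::real_vector \<Rightarrow> 'a"
  assumes lin: "linear f" and B: "independent B" "span B = UNIV" "finite B"
  shows "lin_trace f = (\<Sum>b\<in>B. representation B (f b) b)"
proof -
  define C where "C = (SOME B :: 'a set. independent B \<and> span B = UNIV)"
  have C: "independent C" "span C = UNIV"
    using someI[of "\<lambda>B :: 'a set. independent B \<and> span B = UNIV" B] B by (auto simp: C_def)
  have finC: "finite C"
    using B C independent_span_bound[of B C] by simp
  have repB: "(\<Sum>b\<in>B. representation B v b *\<^sub>R b) = v" for v
    by (rule real_vector.sum_representation_eq) (use B in auto)
  have repC: "(\<Sum>c\<in>C. representation C v c *\<^sub>R c) = v" for v
    by (rule real_vector.sum_representation_eq) (use C finC in auto)
  have lB: "linear (\<lambda>v. representation B v b)" for b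
    by (rule linearI) (use B in \<open>auto simp: real_vector.representation_add real_vector.representation_scale\<close>)
  have lC: "linear (\<lambda>v. representation C v c)" for c
    by (rule linearI) (use C in \<open>auto simp: real_vector.representation_add real_vector.representation_scale\<close>)
  have eB: "representation B (f v) b = (\<Sum>c\<in>C. representation C v c * representation B (f c) b)" for v b
  proof -
    have "representation B (f v) b = representation B (f (\<Sum>c\<in>C. representation C v c *\<^sub>R c)) b"
      by (simp add: repC)
    also have "\<dots> = (\<Sum>c\<in>C. representation C v c * representation B (f c) b)"
      by (simp add: linear_sum[OF lin] linear_sum[OF lB] linear_scale[OF lin] linear_scale[OF lB])
    finally show ?thesis .
  qed
  have eC: "representation C w c = (\<Sum>b\<in>B. representation B w b * representation C b c)" for w c
  proof -
    have "representation C w c = representation C (\<Sum>b\<in>B. representation B w b *\<^sub>R b) c"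
      by (simp add: repB)
    also have "\<dots> = (\<Sum>b\<in>B. representation B w b * representation C b c)"
      by (simp add: linear_sum[OF lC] linear_scale[OF lC])
    finally show ?thesis .
  qed
  have "(\<Sum>b\<in>B. representation B (f b) b)
      = (\<Sum>b\<in>B. \<Sum>c\<in>C. representation C b c * representation B (f c) b)"
    by (subst eB) simp
  also have "\<dots> = (\<Sum>c\<in>C. \<Sum>b\<in>B. representation B (f c) b * representation C b c)"
    by (subst sum.swap) (simp add: mult.commute)
  also have "\<dots> = (\<Sum>c\<in>C. representation C (f c) c)"
    by (simp flip: eC)
  finally show ?thesis
    by (simp add: lin_trace_def Let_def flip: C_def)
qed

lemma riemannian_metric_riesz:
  fixes g :: "'a::real_vector \<Rightarrow> 'a \<Rightarrow> real" and B :: "'a set"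
  assumes g: "riemannian_metric g" and B: "independent B" "span B = UNIV" "finite B"
    and phi: "linear phi"
  shows "\<exists>w. \<forall>z. g w z = phi z"
proof -
  interpret fd: finite_dimensional_vector_space "scaleR :: real \<Rightarrow> 'a \<Rightarrow> 'a" B
    by unfold_locales (use B in \<open>auto simp: algebra_simps dependent_raw_def span_raw_def\<close>)
  have lg: "linear (\<lambda>x. g x z)" "linear (g z)" for z
    using g by (auto simp: riemannian_metric_def bilinear_def)
  define L where "L w = (\<Sum>b\<in>B. g w b *\<^sub>R b)" for w
  have linL: "linear L"
    unfolding L_def
    by (rule linearI) (simp_all add: linear_add[OF lg(1)] linear_scale[OF lg(1)]
        scaleR_add_left sum.distrib scaleR_sum_right)
  have eqB: "u = v" if u: "linear u" and v: "linear v" and "\<And>b. b \<in> B \<Longrightarrow> u b = v b" 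
    for u v :: "'a \<Rightarrow> real"
    using that B(2) by (metis ext linear_eq_on_span UNIV_I)
  have coef: "h b = k b" if "(\<Sum>b\<in>B. h b *\<^sub>R b) = (\<Sum>b\<in>B. k b *\<^sub>R b)" "b \<in> B" for h k b
  proof -
    have "(\<Sum>b\<in>B. (h b - k b) *\<^sub>R b) = 0"
      using that by (simp add: scaleR_diff_left sum_subtractf)
    then show ?thesis
      using independentD[OF B(1) B(3) order_refl, of "\<lambda>b. h b - k b"] that by auto
  qed
  have "inj L"
  proof (rule injI)
    fix x y assume "L x = L y"
    then have "g x b = g y b" if "b \<in> B" for b
      using coef[of "g x" "g y"] that by (simp add: L_def)
    then have "g x = g y"
      by (rule eqB[OF lg(2) lg(2)])
    then have "g (x - y) (x - y) = 0"
      by (simp add: linear_diff[OF lg(1)])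
    then show "x = y"
      using g by (metis riemannian_metric_def less_irrefl right_minus_eq)
  qed
  then have "surj L"
    using fd.linear_inj_imp_surj[of L] linL by (simp add: linear_def)
  then obtain w where w: "L w = (\<Sum>b\<in>B. phi b *\<^sub>R b)"
    by (metis surjD)
  then have "g w b = phi b" if "b \<in> B" for b
    using coef[of "g w" phi] that by (simp add: L_def)
  then have "g w = phi"
    by (rule eqB[OF lg(2) phi])
  then show ?thesis by auto
qed

lemma is_levi_civita_ex1:
  fixes br :: "'a::real_vector \<Rightarrow> 'a \<Rightarrow> 'a"
  assumes dim: "dim (UNIV :: 'a set) = 3" and br: "lie_bracket br" and g: "riemannian_metric g"
  shows "\<exists>!D. is_levi_civita br g D"
proof -
  obtain B :: "'a set" where B: "independent B" "span B = UNIV" "card B = 3"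
    using basis_exists[of "UNIV :: 'a set"] dim by (metis top.extremum_unique)
  then have finB: "finite B" by (metis card.infinite zero_neq_numeral)
  have sym: "g x y = g y x" for x y
    using g by (auto simp: riemannian_metric_def)
  have lg: "linear (\<lambda>x. g x z)" "linear (g z)" for z
    using g by (auto simp: riemannian_metric_def bilinear_def)
  have lb: "linear (\<lambda>x. br x z)" "linear (br z)" for z
    using br by (auto simp: lie_bracket_def bilinear_def)
  note lins = linear_add[OF lg(1)] linear_add[OF lg(2)] linear_add[OF lb(1)] linear_add[OF lb(2)]
    linear_scale[OF lg(1)] linear_scale[OF lg(2)] linear_scale[OF lb(1)] linear_scale[OF lb(2)]
    linear_diff[OF lg(1)] linear_diff[OF lg(2)]
  have anti: "br x y = - br y x" for x y
  proof -
    have "br (x + y) (x + y) = 0" "br x x = 0" "br y y = 0"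
      using br by (auto simp: lie_bracket_def)
    then have "br x y + br y x = 0"
      by (simp add: lins add.commute)
    then show ?thesis by (simp add: eq_neg_iff_add_eq_0)
  qed
  have gneg: "g (- x) y = - g x y" for x y
    using linear_neg[OF lg(1)] .
  have ext: "x = y" if "\<And>z. g x z = g y z" for x y
  proof -
    have "g (x - y) (x - y) = 0"
      using that by (simp add: lins)
    then show ?thesis
      using g by (metis riemannian_metric_def less_irrefl right_minus_eq)
  qed
  define K where "K x y z = (g (br x y) z - g (br y z) x + g (br z x) y) / 2" for x y z
  have koszul: "g (D x y) z = K x y z" if D: "is_levi_civita br g D" for D x y z
  proof -
    have t: "g (D u v) w - g (D v u) w = g (br u v) w" for u v w
      using D by (metis is_levi_civita_def linear_diff[OF lg(1)])
    have m: "g (D u v) w = - g (D u w) v" for u v w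
      using D sym by (metis is_levi_civita_def eq_neg_iff_add_eq_0)
    show ?thesis
      using t[of x y z] t[of y z x] t[of z x y] m[of x y z] m[of y z x] m[of z x y]
      by (simp add: K_def)
  qed
  have linK: "linear (K x y)" for x y
    by (rule linearI) (simp_all add: K_def lins field_simps)
  define D where "D x y = (SOME w. \<forall>z. g w z = K x y z)" for x y
  have gD: "g (D x y) z = K x y z" for x y z
    using someI_ex[OF riemannian_metric_riesz[OF g B(1,2) finB linK]] by (simp add: D_def)
  show ?thesis
  proof (rule ex1I[of _ D])
    have "bilinear D"
      unfolding bilinear_def
      by (intro conjI allI linearI ext) (simp_all add: gD K_def lins field_simps)
    moreover have "D x y - D y x = br x y" for x y
    proof (rule ext)
      fix z
      have "g (br y x) z = - g (br x y) z" "g (br x z) y = - g (br z x) y" "g (br z y) x = - g (br y z) x"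
        using anti gneg by metis+
      then show "g (D x y - D y x) z = g (br x y) z"
        by (simp add: lins gD K_def field_simps)
    qed
    moreover have "g (D x y) z + g y (D x z) = 0" for x y z
    proof -
      have "g (br x y) z = - g (br y x) z" "g (br x z) y = - g (br z x) y" "g (br z y) x = - g (br y z) x"
        using anti gneg by metis+
      then show ?thesis
        by (simp add: sym[of y] gD K_def field_simps)
    qed
    ultimately show "is_levi_civita br g D"
      by (simp add: is_levi_civita_def)
  next
    fix D' assume "is_levi_civita br g D'"
    then show "D' = D"
      by (intro HOL.ext ext) (simp add: koszul gD)
  qed
qed

end

theory Submission
  imports Defs
begin

text \<open>
  Let \<open>V\<close> be a Milnor basis with constants \<open>l\<close> that is orthogonal for a metric \<open>g\<close>, let
  \<open>a\<^sub>i = g(V\<^sub>i, V\<^sub>i)\<close> and write \<open>y\<^sub>i = l\<^sub>i a\<^sub>i\<close>.  In the coordinates of \<open>V\<close> the bracket is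
  \<open>[x, y] = l * (x \<times> y)\<close>, with \<open>*\<close> the componentwise product, and the Levi-Civita connection is
  \<open>D\<^sub>x y = (q * x \<times> y) / (2 a)\<close> with \<open>q\<^sub>1 = y\<^sub>2 + y\<^sub>3 - y\<^sub>1\<close> and cyclically.  A computation then shows that
  the Ricci form is diagonal in \<open>V\<close> with \<open>Ric(V\<^sub>1, V\<^sub>1) = q\<^sub>2 q\<^sub>3 / (2 a\<^sub>2 a\<^sub>3)\<close>
  (\<open>milnor_frame_ricci\<close>).

  Every metric admits such a basis, with the same constants \<open>l\<close> (\<open>orthogonal_milnor_basis\<close>).  In the
  coordinates of any Milnor basis let \<open>G\<close> be the Gram matrix of \<open>g\<close>.  The form \<open>g\<close> and the form
  \<open>Gx \<bullet> (l * Gy)\<close> have a common orthogonal basis.  By the law of inertia the values of the second form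
  on that basis have, after a permutation, the signs of \<open>l\<^sub>1, l\<^sub>2, l\<^sub>3\<close>.  Orthogonality forces
  \<open>[z\<^sub>i, z\<^sub>j]\<close> to be a multiple of \<open>z\<^sub>k\<close>, with a factor of that sign once the basis is positively oriented,
  and positive scalings of the \<open>z\<^sub>k\<close> turn the factors into the \<open>l\<^sub>k\<close>.

  Hence \<open>Ric(g) = c T\<close> is solvable if and only if \<open>T\<close> is diagonal in some Milnor basis and its diagonal
  entries solve \<open>c T\<^sub>1 = q\<^sub>2 q\<^sub>3 / (2 a\<^sub>2 a\<^sub>3)\<close> and its cyclic companions with positive \<open>a\<^sub>i\<close> and \<open>c\<close>
  (\<open>prescribed_ricci_iff_realizable\<close>).  What remains concerns real numbers only.

  The constraints follow from these equations by reading off signs of \<open>q\<^sub>1, q\<^sub>2, q\<^sub>3\<close>, of which no two can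
  be simultaneously negative in the case of \<open>SO(3)\<close>.  Conversely, if some \<open>l\<^sub>i\<close> vanishes, a solution can
  be written down.  If \<open>l\<^sub>i = 2 e\<^sub>i\<close> with \<open>e\<^sub>i = \<plusminus>1\<close>, set \<open>U\<^sub>i = e\<^sub>i T\<^sub>i\<close>.  For a suitable
  constant \<open>p\<close> the equations say that \<open>q\<^sub>i\<close> is proportional to \<open>1 / (U\<^sub>i + p)\<close>, and they are compatible
  if and only if \<open>p\<close> is a root of \<open>2 p\<^sup>3 + (U\<^sub>1 + U\<^sub>2 + U\<^sub>3) p\<^sup>2 - U\<^sub>1 U\<^sub>2 U\<^sub>3\<close>; the \<open>a\<^sub>i\<close> are positive
  when \<open>p\<close> lies in a suitable interval (\<open>ricci_cubic_root_realizable\<close>).  For \<open>SL(2)\<close> the values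
  \<open>- U\<^sub>i (U\<^sub>i - U\<^sub>j) (U\<^sub>i - U\<^sub>k)\<close> of the cubic at \<open>- U\<^sub>i\<close> have signs that force a root in that interval; for
  \<open>SO(3)\<close> its values at \<open>0\<close> and at the critical point \<open>- (T\<^sub>1 + T\<^sub>2 + T\<^sub>3) / 3\<close> do so.  The boundary cases, in
  which two of the \<open>T\<^sub>i\<close> vanish or \<open>T\<^sub>3 = - T\<^sub>1 = - T\<^sub>2\<close>, have explicit solutions.
\<close>

section \<open>Coordinates in a basis and the Ricci form of an orthogonal Milnor basis\<close>

definition lincomb :: "(3 \<Rightarrow> 'a::real_vector) \<Rightarrow> real ^ 3 \<Rightarrow> 'a" where
  "lincomb V x = (\<Sum>i\<in>UNIV. (x $ i) *\<^sub>R V i)"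

lemma linear_lincomb: "linear (lincomb V)"
  by (rule linearI) (simp_all add: lincomb_def scaleR_add_left sum.distrib scaleR_sum_right)

lemma lincomb_axis [simp]: "lincomb V (axis i 1) = V i"
proof -
  have "lincomb V (axis i 1) = (\<Sum>j\<in>UNIV. if j = i then V j else 0)"
    unfolding lincomb_def by (intro sum.cong) (auto simp: axis_def)
  then show ?thesis by simp
qed

lemma lincomb_inj:
  assumes "is_basis V" "lincomb V x = lincomb V y"
  shows "x = y"
proof -
  have V: "inj V" "independent (range V)"
    using assms(1) by (auto simp: is_basis_def)
  have "(\<Sum>v\<in>range V. ((x - y) $ inv V v) *\<^sub>R v) = (\<Sum>i\<in>UNIV. ((x - y) $ i) *\<^sub>R V i)"
    using V(1) by (simp add: sum.reindex)
  also have "\<dots> = 0"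
    using assms(2) by (simp add: lincomb_def scaleR_diff_left sum_subtractf)
  finally have "(x - y) $ inv V (V i) = 0" for i
    using independentD[OF V(2) _ order_refl, of "\<lambda>v. (x - y) $ inv V v" "V i"] by simp
  then show ?thesis
    using V(1) by (simp add: vec_eq_iff)
qed

lemma lincomb_surj:
  assumes "is_basis V"
  obtains x where "v = lincomb V x"
proof -
  have V: "inj V" "span (range V) = UNIV"
    using assms by (auto simp: is_basis_def)
  have "v \<in> range (\<lambda>u. \<Sum>w\<in>range V. u w *\<^sub>R w)"
    using V(2) real_vector.span_finite[of "range V"] by auto
  then obtain u where "v = (\<Sum>w\<in>range V. u w *\<^sub>R w)"
    by auto
  also have "\<dots> = lincomb V (\<chi> i. u (V i))"
    using V(1) by (simp add: sum.reindex lincomb_def)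
  finally show ?thesis by (rule that)
qed

lemma is_basis_nonzero: "is_basis V \<Longrightarrow> V i \<noteq> 0"
  by (metis is_basis_def rangeI real_vector.dependent_zero)

lemma lin_trace_lincomb:
  assumes V: "is_basis V" and f: "linear f" and F: "\<And>i. f (V i) = lincomb V (F i)"
  shows "lin_trace f = (\<Sum>i\<in>UNIV. F i $ i)"
proof -
  have V': "inj V" "independent (range V)" "span (range V) = UNIV"
    using V by (auto simp: is_basis_def)
  have rep: "representation (range V) (lincomb V x) (V j) = x $ j" for x j
  proof -
    have "representation (range V) (lincomb V x) (V j)
        = (\<Sum>i\<in>UNIV. x $ i * representation (range V) (V i) (V j))"
      unfolding lincomb_def using V'
      by (subst real_vector.representation_sum) (simp_all add: real_vector.representation_scale)
    also have "\<dots> = (\<Sum>i\<in>UNIV. if i = j then x $ i else 0)"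
      using V' by (intro sum.cong) (auto simp: real_vector.representation_basis inj_eq)
    finally show ?thesis by simp
  qed
  have "lin_trace f = (\<Sum>v\<in>range V. representation (range V) (f v) v)"
    using V' by (intro lin_trace_eq[OF f]) auto
  then show ?thesis
    using V' by (simp add: sum.reindex F rep)
qed

lemma bilinear_lincomb:
  assumes "bilinear h"
  shows "h (lincomb V x) (lincomb V y) = (\<Sum>i\<in>UNIV. \<Sum>j\<in>UNIV. (x $ i * y $ j) *\<^sub>R h (V i) (V j))"
  using assms unfolding lincomb_def by (simp add: bilinear_sum sum.cartesian_product bilinear_lmul bilinear_rmul mult.commute)

text \<open>
  By antisymmetry the nine bracket relations of a Milnor basis reduce to the three cyclic ones.
\<close>

lemma milnor_basis_iff:
  assumes br: "lie_bracket br"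
  shows "milnor_basis br l V \<longleftrightarrow> is_basis V \<and>
    br (V 1) (V 2) = (l $ 3) *\<^sub>R V 3 \<and> br (V 2) (V 3) = (l $ 1) *\<^sub>R V 1 \<and> br (V 3) (V 1) = (l $ 2) *\<^sub>R V 2"
proof -
  have z: "br x x = 0" for x
    using br by (simp add: lie_bracket_def)
  have bil: "bilinear br"
    using br by (simp add: lie_bracket_def)
  have "br (x + y) (x + y) = br x x + br x y + br y x + br y y" for x y
    using bil by (simp add: bilinear_ladd bilinear_radd)
  then have anti: "br x y = - br y x" for x y
    using z by (metis add.left_neutral add.right_neutral eq_neg_iff_add_eq_0)
  show ?thesis
    unfolding milnor_basis_def forall_3 sum_3 levi_civita_symbol_def
    using anti[of "V 2" "V 1"] anti[of "V 3" "V 2"] anti[of "V 1" "V 3"] by (auto simp: z)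
qed

text \<open>
  A Milnor basis identifies the Lie algebra with \<open>\<real>\<^sup>3\<close>, where the bracket is a componentwise rescaling
  of the cross product.
\<close>

lemma milnor_basis_lincomb:
  assumes br: "lie_bracket br" and V: "milnor_basis br l V"
  shows "br (lincomb V x) (lincomb V y) = lincomb V (\<chi> k. l $ k * cross3 x y $ k)"
proof -
  have bil: "bilinear br"
    using br by (simp add: lie_bracket_def)
  have "br (V i) (V j) = (\<Sum>k\<in>UNIV. (levi_civita_symbol i j k * l $ k) *\<^sub>R V k)" for i j
    using V by (simp add: milnor_basis_def)
  then show ?thesis
    by (simp add: bilinear_lincomb[OF bil] sum_3 levi_civita_symbol_def)
      (simp add: lincomb_def sum_3 cross_components algebra_simps)
qed

text \<open>
  The connection is guessed, and recognized by uniqueness.  It is metric, because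
  \<open>g (D x y) z = (q * x \<times> y) \<bullet> z / 2\<close> is alternating in \<open>y\<close> and \<open>z\<close>.  It is torsion-free, because
  the \<open>V\<^sub>3\<close>-component of \<open>D V\<^sub>1 V\<^sub>2 - D V\<^sub>2 V\<^sub>1\<close> is \<open>(q\<^sub>1 + q\<^sub>2) / (2 a\<^sub>3) = l\<^sub>3\<close>.
\<close>

lemma milnor_frame_levi_civita:
  assumes dim: "dim (UNIV :: 'a::real_vector set) = 3" and br: "lie_bracket (br :: 'a \<Rightarrow> 'a \<Rightarrow> 'a)"
    and V: "milnor_basis br l V" and g: "riemannian_metric g"
    and orth: "\<And>i j. i \<noteq> j \<Longrightarrow> g (V i) (V j) = 0"
    and a: "\<And>i. a $ i = g (V i) (V i)"
    and q: "q = vector [l $ 2 * a $ 2 + l $ 3 * a $ 3 - l $ 1 * a $ 1,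
      l $ 3 * a $ 3 + l $ 1 * a $ 1 - l $ 2 * a $ 2, l $ 1 * a $ 1 + l $ 2 * a $ 2 - l $ 3 * a $ 3]"
  shows "levi_civita br g (lincomb V x) (lincomb V y) =
    lincomb V (\<chi> k. cross3 (\<chi> i. q $ i * x $ i) y $ k / (2 * a $ k))"
proof -
  have basis: "is_basis V"
    using V by (simp add: milnor_basis_def)
  have bilg: "bilinear g"
    using g by (simp add: riemannian_metric_def)
  define d where "d x y = (\<chi> k. cross3 (\<chi> i. q $ i * x $ i) y $ k / (2 * a $ k))" for x y :: "real^3"
  define c where "c v = (THE x. v = lincomb V x)" for v
  have c [simp]: "c (lincomb V x) = x" for x
    unfolding c_def using lincomb_inj[OF basis] by blast
  define D where "D v w = lincomb V (d (c v) (c w))" for v w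
  have D: "D (lincomb V x) (lincomb V y) = lincomb V (d x y)" for x y
    by (simp add: D_def)
  have apos: "a $ i > 0" for i
    using g is_basis_nonzero[OF basis, of i] by (simp add: a riemannian_metric_def)
  have g_coord: "g (lincomb V x) (lincomb V y) = (\<Sum>i\<in>UNIV. a $ i * x $ i * y $ i)" for x y
    by (simp add: bilinear_lincomb[OF bilg] sum_3 orth a)
  have coord: "\<exists>x. v = lincomb V x" for v
    using lincomb_surj[OF basis] by blast
  note lin = linear_add[OF linear_lincomb, symmetric] linear_scale[OF linear_lincomb, symmetric]
    linear_diff[OF linear_lincomb, symmetric]
  have d_bilinear: "d x (y + z) = d x y + d x z" "d (y + z) x = d y x + d z x"
    "d x (r *\<^sub>R y) = r *\<^sub>R d x y" "d (r *\<^sub>R y) x = r *\<^sub>R d y x" for x y z r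
    by (simp_all add: d_def vec_eq_iff forall_3 cross_components field_simps add_divide_distrib diff_divide_distrib)
  have "is_levi_civita br g D"
    unfolding is_levi_civita_def
  proof (intro conjI allI)
    show "bilinear D"
      unfolding bilinear_def
    proof (intro conjI allI linearI)
      fix u v w and r :: real
      obtain x y z where [simp]: "u = lincomb V x" "v = lincomb V y" "w = lincomb V z"
        using coord by metis
      show "D u (v + w) = D u v + D u w" "D (v + w) u = D v u + D w u"
        "D u (r *\<^sub>R v) = r *\<^sub>R D u v" "D (r *\<^sub>R v) u = r *\<^sub>R D v u"
        by (simp_all only: D lin \<open>u = _\<close> \<open>v = _\<close> \<open>w = _\<close> d_bilinear)
    qed
    fix u v w
    obtain x y z where [simp]: "u = lincomb V x" "v = lincomb V y" "w = lincomb V z"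
      using coord by metis
    have "d x y - d y x = (\<chi> k. l $ k * cross3 x y $ k)"
      using apos[of 1] apos[of 2] apos[of 3]
      by (simp add: d_def vec_eq_iff forall_3 cross_components q field_simps)
    then show "D u v - D v u = br u v"
      by (simp add: D lin milnor_basis_lincomb[OF br V])
    show "g (D u v) w + g v (D u w) = 0"
      using apos[of 1] apos[of 2] apos[of 3]
      by (simp add: D g_coord) (simp add: d_def sum_3 cross_components field_simps)
  qed
  then have "levi_civita br g = D"
    unfolding levi_civita_def by (intro the1_equality is_levi_civita_ex1[OF dim br g])
  then show ?thesis
    by (simp add: D d_def)
qed

text \<open>
  The Ricci curvature \<open>Ric(V\<^sub>1, V\<^sub>1)\<close> of a metric that is diagonal in a Milnor basis with constants \<open>l\<^sub>i\<close>,
  with diagonal entries \<open>a\<^sub>i\<close>.  The other two diagonal entries arise by cyclic rotation of the indices.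
\<close>

definition principal_ricci :: "real \<Rightarrow> real \<Rightarrow> real \<Rightarrow> real \<Rightarrow> real \<Rightarrow> real \<Rightarrow> real" where
  "principal_ricci l1 l2 l3 a1 a2 a3 =
     (l3 * a3 + l1 * a1 - l2 * a2) * (l1 * a1 + l2 * a2 - l3 * a3) / (2 * a2 * a3)"

text \<open>
  All the data are polynomial in the coordinates, so the curvature \<open>x \<mapsto> R(x, y) z\<close> becomes an explicit
  linear map of \<open>\<real>\<^sup>3\<close> whose trace can be computed.
\<close>

lemma milnor_frame_ricci:
  assumes dim: "dim (UNIV :: 'a::real_vector set) = 3" and br: "lie_bracket (br :: 'a \<Rightarrow> 'a \<Rightarrow> 'a)"
    and V: "milnor_basis br l V" and g: "riemannian_metric g"
    and orth: "\<And>i j. i \<noteq> j \<Longrightarrow> g (V i) (V j) = 0"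
    and a: "\<And>i. a $ i = g (V i) (V i)"
  shows "ricci br g (lincomb V y) (lincomb V z) =
     principal_ricci (l $ 1) (l $ 2) (l $ 3) (a $ 1) (a $ 2) (a $ 3) * y $ 1 * z $ 1 +
     principal_ricci (l $ 2) (l $ 3) (l $ 1) (a $ 2) (a $ 3) (a $ 1) * y $ 2 * z $ 2 +
     principal_ricci (l $ 3) (l $ 1) (l $ 2) (a $ 3) (a $ 1) (a $ 2) * y $ 3 * z $ 3"
proof -
  have basis: "is_basis V"
    using V by (simp add: milnor_basis_def)
  define q :: "real^3" where q: "q = vector [l $ 2 * a $ 2 + l $ 3 * a $ 3 - l $ 1 * a $ 1,
      l $ 3 * a $ 3 + l $ 1 * a $ 1 - l $ 2 * a $ 2, l $ 1 * a $ 1 + l $ 2 * a $ 2 - l $ 3 * a $ 3]"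
  define d where "d x y = (\<chi> k. cross3 (\<chi> i. q $ i * x $ i) y $ k / (2 * a $ k))" for x y :: "real^3"
  note D = milnor_frame_levi_civita[OF dim br V g orth a q, folded d_def]
  define R where "R x = d x (d y z) - d y (d x z) - d (\<chi> k. l $ k * cross3 x y $ k) z" for x
  have curv: "curvature br g (lincomb V x) (lincomb V y) (lincomb V z) = lincomb V (R x)" for x
    by (simp add: curvature_def Let_def D milnor_basis_lincomb[OF br V] R_def
        linear_diff[OF linear_lincomb])
  have linR: "linear R"
    by (rule linearI)
      (simp_all add: R_def d_def vec_eq_iff forall_3 cross_components field_simps add_divide_distrib diff_divide_distrib)
  have lin: "linear (\<lambda>v. curvature br g v (lincomb V y) (lincomb V z))"
  proof (rule linearI)
    fix u v and r :: real
    obtain x x' where [simp]: "u = lincomb V x" "v = lincomb V x'"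
      using lincomb_surj[OF basis] by metis
    show "curvature br g (u + v) (lincomb V y) (lincomb V z) =
        curvature br g u (lincomb V y) (lincomb V z) + curvature br g v (lincomb V y) (lincomb V z)"
      by (simp add: linear_add[OF linear_lincomb, symmetric] curv linear_add[OF linR])
    show "curvature br g (r *\<^sub>R u) (lincomb V y) (lincomb V z) =
        r *\<^sub>R curvature br g u (lincomb V y) (lincomb V z)"
      by (simp add: linear_scale[OF linear_lincomb, symmetric] curv linear_scale[OF linR])
  qed
  have pos: "a $ i > 0" for i
    using g is_basis_nonzero[OF basis, of i] by (simp add: a riemannian_metric_def)
  have "ricci br g (lincomb V y) (lincomb V z) = (\<Sum>i\<in>UNIV. R (axis i 1) $ i)"
    unfolding ricci_def
    by (rule lin_trace_lincomb[OF basis lin]) (simp add: curv[symmetric])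
  also have "\<dots> = principal_ricci (l $ 1) (l $ 2) (l $ 3) (a $ 1) (a $ 2) (a $ 3) * y $ 1 * z $ 1 +
     principal_ricci (l $ 2) (l $ 3) (l $ 1) (a $ 2) (a $ 3) (a $ 1) * y $ 2 * z $ 2 +
     principal_ricci (l $ 3) (l $ 1) (l $ 2) (a $ 3) (a $ 1) (a $ 2) * y $ 3 * z $ 3"
    using pos[of 1] pos[of 2] pos[of 3]
    by (simp add: sum_3 R_def d_def cross_components axis_def principal_ricci_def q field_simps)
  finally show ?thesis .
qed

section \<open>Simultaneous diagonalization and the law of inertia\<close>

text \<open>
  A maximizer \<open>u\<close> of the quotient \<open>q x x / g x x\<close>, with maximal value \<open>r\<close>, exists on \<open>S\<close> by compactness
  of the unit sphere.  The form \<open>r g - q\<close> is positive semidefinite on \<open>S\<close> and vanishes at \<open>u\<close>, so \<open>u\<close> lies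
  in its kernel; hence the \<open>g\<close>-orthogonal complement of \<open>u\<close> in \<open>S\<close> is \<open>q\<close>-orthogonal to \<open>u\<close> as well, and
  induction on the dimension applies to it.
\<close>

lemma simultaneous_orthogonal_basis:
  fixes g q :: "'a::euclidean_space \<Rightarrow> 'a \<Rightarrow> real"
  assumes g: "bilinear g" "\<And>x y. g x y = g y x" "\<And>x. x \<noteq> 0 \<Longrightarrow> g x x > 0"
    and q: "bilinear q" "\<And>x y. q x y = q y x"
    and S: "subspace S"
  shows "\<exists>B. independent B \<and> span B = S \<and>
    (\<forall>x\<in>B. \<forall>y\<in>B. x \<noteq> y \<longrightarrow> g x y = 0 \<and> q x y = 0)"
  using S
proof (induction "dim S" arbitrary: S rule: less_induct)
  case less
  note S = \<open>subspace S\<close>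
  show ?case
  proof (cases "S = {0}")
    case True
    have "independent ({} :: 'a set)"
      by (rule independent_empty)
    with True show ?thesis
      by (metis empty_iff span_empty)
  next
    case False
    define K where "K = S \<inter> sphere 0 1"
    obtain x0 where x0: "x0 \<in> S" "x0 \<noteq> 0"
      using False subspace_0[OF S] by blast
    then have "(1 / norm x0) *\<^sub>R x0 \<in> K"
      using S by (simp add: K_def subspace_scale)
    then have K_ne: "K \<noteq> {}" by blast
    have K_compact: "compact K"
      unfolding K_def using closed_subspace[OF S] by (intro closed_Int_compact) auto
    have cont: "continuous_on A (\<lambda>x. h x x)" if "bilinear h" for h :: "'a \<Rightarrow> 'a \<Rightarrow> real" and A
      using bounded_bilinear.continuous_on[OF bilinear_conv_bounded_bilinear[THEN iffD1, OF that] continuous_on_id continuous_on_id] .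
    have "continuous_on K (\<lambda>x. q x x / g x x)"
    proof (rule continuous_on_divide[OF cont[OF q(1)] cont[OF g(1)]])
      show "\<forall>x\<in>K. g x x \<noteq> 0"
      proof
        fix x assume "x \<in> K"
        then have "x \<noteq> 0" by (auto simp: K_def)
        then show "g x x \<noteq> 0" using g(3)[of x] by simp
      qed
    qed
    from continuous_attains_sup[OF K_compact K_ne this]
    obtain u where u: "u \<in> K" and max: "\<forall>x\<in>K. q x x / g x x \<le> q u u / g u u"
      by blast
    define r where "r = q u u / g u u"
    have u0: "u \<noteq> 0" and uS: "u \<in> S"
      using u by (auto simp: K_def)
    have guu: "g u u > 0" using g u0 by blast
    have lin: "h (x + y) z = h x z + h y z" "h z (x + y) = h z x + h z y"
        "h (c *\<^sub>R x) y = c * h x y" "h x (c *\<^sub>R y) = c * h x y"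
        "h (x - y) z = h x z - h y z" "h z (x - y) = h z x - h z y"
        if "bilinear h" for h :: "'a \<Rightarrow> 'a \<Rightarrow> real" and x y z c
      using that by (simp_all add: bilinear_ladd bilinear_radd bilinear_lmul bilinear_rmul bilinear_lsub bilinear_rsub)
    have le: "q x x \<le> r * g x x" if "x \<in> S" for x
    proof (cases "x = 0")
      case True
      then show ?thesis using g(1) q(1) by (simp add: bilinear_lzero)
    next
      case False
      define c where "c = 1 / norm x"
      have c: "c > 0" "c *\<^sub>R x \<in> K"
        using False that S by (simp_all add: c_def K_def subspace_scale)
      have "q x x / g x x \<le> r"
        using max[THEN bspec, OF c(2)] c(1) by (simp add: lin[OF g(1)] lin[OF q(1)] r_def)
      then show ?thesis
        using g(3)[OF False] by (simp add: divide_le_eq)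
    qed
    have qu: "q u x = r * g u x" if x: "x \<in> S" for x
    proof (rule ccontr)
      assume ne: "q u x \<noteq> r * g u x"
      define A where "A = r * g x x - q x x"
      define b where "b = q u x - r * g u x"
      have "A \<ge> 0" using le[OF x] by (simp add: A_def)
      \<comment> \<open>The inequality \<open>q \<le> r g\<close> at \<open>u + t x\<close>, expanded in \<open>t\<close>; for small \<open>t\<close> it forces \<open>b = 0\<close>.\<close>
      have quad: "2 * t * b \<le> t\<^sup>2 * A" for t
      proof -
        have "u + t *\<^sub>R x \<in> S"
          using x uS S by (simp add: subspace_add subspace_scale)
        from le[OF this] have "q u u + 2 * t * q u x + t\<^sup>2 * q x x \<le> r * (g u u + 2 * t * g u x + t\<^sup>2 * g x x)"
          by (simp add: lin[OF g(1)] lin[OF q(1)] g(2)[of x u] q(2)[of x u] power2_eq_square algebra_simps)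
        moreover have "q u u = r * g u u"
          using guu by (simp add: r_def)
        ultimately show ?thesis
          by (simp add: A_def b_def algebra_simps)
      qed
      have "b \<noteq> 0" using ne by (simp add: b_def)
      define t where "t = b / (A + 1)"
      have t: "t \<noteq> 0" "b = t * (A + 1)"
        using \<open>b \<noteq> 0\<close> \<open>A \<ge> 0\<close> by (auto simp: t_def)
      have "t\<^sup>2 * (A + 2) \<le> 0"
        using quad[of t] by (simp add: t(2) power2_eq_square algebra_simps)
      moreover have "t\<^sup>2 * (A + 2) > 0"
        using t(1) \<open>A \<ge> 0\<close> by simp
      ultimately show False by simp
    qed
    define S' where "S' = {x \<in> S. g u x = 0}"
    have S': "subspace S'"
      using S unfolding S'_def subspace_def by (auto simp: lin[OF g(1)] bilinear_rzero[OF g(1)])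
    have "u \<notin> S'" using guu by (simp add: S'_def)
    then have "S' \<subset> S" using uS by (auto simp: S'_def)
    then have "dim S' < dim S"
      using S S' by (intro dim_psubset) (simp add: span_eq_iff[THEN iffD2])
    from less.hyps[OF this S'] obtain B where B: "independent B" "span B = S'"
        "\<forall>x\<in>B. \<forall>y\<in>B. x \<noteq> y \<longrightarrow> g x y = 0 \<and> q x y = 0"
      by blast
    have BS: "x \<in> S" "g u x = 0" "g x u = 0" "q u x = 0" "q x u = 0" if "x \<in> B" for x
      using that B(2) span_base[OF that] qu[of x] g(2)[of x u] q(2)[of x u] by (auto simp: S'_def)
    have "span (insert u B) = S"
    proof
      show "span (insert u B) \<subseteq> S"
        using BS(1) uS S by (intro span_minimal) auto
      show "S \<subseteq> span (insert u B)"
      proof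
        fix x assume x: "x \<in> S"
        define y where "y = x - (g u x / g u u) *\<^sub>R u"
        have "y \<in> S'"
          using guu x uS S by (simp add: y_def S'_def lin[OF g(1)] subspace_diff subspace_scale)
        then have "y \<in> span (insert u B)"
          using B(2) span_mono[of B "insert u B"] by blast
        moreover have "(g u x / g u u) *\<^sub>R u \<in> span (insert u B)"
          by (simp add: span_base span_scale)
        ultimately have "y + (g u x / g u u) *\<^sub>R u \<in> span (insert u B)"
          by (rule span_add)
        then show "x \<in> span (insert u B)" by (simp add: y_def)
      qed
    qed
    moreover have "independent (insert u B)"
      using B(1,2) \<open>u \<notin> S'\<close> by (simp add: independent_insert)
    ultimately show ?thesis
      using B(3) BS by (intro exI[of _ "insert u B"]) auto
  qed
qed

text \<open>
  The form is positive definite on the span of the \<open>u i\<close> with \<open>p (u i) (u i) > 0\<close> and nonpositive on the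
  span of the \<open>v i\<close> with \<open>p (v i) (v i) \<le> 0\<close>.  The two spans therefore meet in \<open>0\<close>, so their dimensions
  add up to at most \<open>CARD('n)\<close>.
\<close>

lemma inertia_le:
  fixes p :: "'a::euclidean_space \<Rightarrow> 'a \<Rightarrow> real" and u v :: "'n::finite \<Rightarrow> 'a"
  assumes p: "bilinear p"
    and u: "inj u" "independent (range u)" "\<And>i j. i \<noteq> j \<Longrightarrow> p (u i) (u j) = 0"
    and v: "inj v" "independent (range v)" "\<And>i j. i \<noteq> j \<Longrightarrow> p (v i) (v j) = 0"
    and dim: "DIM('a) = CARD('n)"
  shows "card {i. p (u i) (u i) > 0} \<le> card {i. p (v i) (v i) > 0}"
proof -
  have expand: "\<exists>c. x = (\<Sum>i\<in>I. c i *\<^sub>R w i) \<and> p x x = (\<Sum>i\<in>I. (c i)\<^sup>2 * p (w i) (w i))"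
    if "inj w" "\<And>i j. i \<noteq> j \<Longrightarrow> p (w i) (w j) = 0" "x \<in> span (w ` I)" for w :: "'n \<Rightarrow> 'a" and I x
  proof -
    obtain b where "x = (\<Sum>y\<in>w ` I. b y *\<^sub>R y)"
      using \<open>x \<in> span (w ` I)\<close> span_finite[of "w ` I"] by auto
    then have x: "x = (\<Sum>i\<in>I. b (w i) *\<^sub>R w i)"
      using \<open>inj w\<close> by (simp add: sum.reindex inj_on_def inj_def)
    have "p x x = (\<Sum>i\<in>I. \<Sum>j\<in>I. b (w i) * b (w j) * p (w i) (w j))"
      unfolding x using p by (simp add: bilinear_sum sum.cartesian_product bilinear_lmul bilinear_rmul mult_ac)
    also have "\<dots> = (\<Sum>i\<in>I. \<Sum>j\<in>I. if j = i then (b (w i))\<^sup>2 * p (w i) (w i) else 0)"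
      using that(2) by (intro sum.cong refl) (auto simp: power2_eq_square)
    finally show ?thesis
      using x by (intro exI[of _ "\<lambda>i. b (w i)"]) simp
  qed
  define I where "I = {i. p (u i) (u i) > 0}"
  define J where "J = {i. \<not> p (v i) (v i) > 0}"
  have "span (u ` I) \<inter> span (v ` J) \<subseteq> {0}"
  proof
    fix x assume x: "x \<in> span (u ` I) \<inter> span (v ` J)"
    obtain c where c: "x = (\<Sum>i\<in>I. c i *\<^sub>R u i)" "p x x = (\<Sum>i\<in>I. (c i)\<^sup>2 * p (u i) (u i))"
      using expand[OF u(1,3) IntD1[OF x]] by blast
    obtain d where d: "p x x = (\<Sum>i\<in>J. (d i)\<^sup>2 * p (v i) (v i))"
      using expand[OF v(1,3) IntD2[OF x]] by blast
    have "p x x \<le> 0"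
      unfolding d by (intro sum_nonpos mult_nonneg_nonpos) (auto simp: J_def)
    moreover have nonneg: "\<And>i. i \<in> I \<Longrightarrow> 0 \<le> (c i)\<^sup>2 * p (u i) (u i)"
      by (simp add: I_def)
    moreover have "0 \<le> p x x"
      unfolding c(2) using nonneg by (rule sum_nonneg)
    ultimately have "(\<Sum>i\<in>I. (c i)\<^sup>2 * p (u i) (u i)) = 0"
      using c(2) by (metis order.antisym)
    then have "\<forall>i\<in>I. (c i)\<^sup>2 * p (u i) (u i) = 0"
      using sum_nonneg_eq_0_iff[OF finite nonneg, of I] by (rule iffD1[rotated])
    then have "\<forall>i\<in>I. c i = 0"
      by (auto simp: I_def)
    then have "(\<Sum>i\<in>I. c i *\<^sub>R u i) = 0"
      by (intro sum.neutral ballI) simp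
    then show "x \<in> {0}" by (simp only: c(1) singleton_iff)
  qed
  then have "dim (span (u ` I) \<inter> span (v ` J)) = 0"
    by simp
  moreover have "dim {x + y |x y. x \<in> span (u ` I) \<and> y \<in> span (v ` J)} \<le> CARD('n)"
    unfolding dim[symmetric] by (rule dim_subset_UNIV)
  moreover have span_dim: "dim (span (w ` K)) = card K" if "inj w" "independent (range w)"
    for w :: "'n \<Rightarrow> 'a" and K
  proof -
    have "dim (w ` K) = card (w ` K)"
      using dim_eq_card_independent[OF independent_mono[OF that(2) image_mono[OF subset_UNIV]]] .
    also have "\<dots> = card K"
      by (rule card_image[OF inj_on_subset[OF that(1) subset_UNIV]])
    finally show ?thesis by simp
  qed
  ultimately have "card I + card J \<le> CARD('n)"
    using dim_sums_Int[OF subspace_span[of "u ` I"] subspace_span[of "v ` J"]]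
    unfolding span_dim[OF u(1,2)] span_dim[OF v(1,2)] by linarith
  moreover have "card J + card {i. p (v i) (v i) > 0} = CARD('n)"
  proof -
    have "card (J \<union> {i. p (v i) (v i) > 0}) = card J + card {i. p (v i) (v i) > 0}"
      by (intro card_Un_disjoint) (auto simp: J_def)
    moreover have "J \<union> {i. p (v i) (v i) > 0} = UNIV"
      by (auto simp: J_def)
    ultimately show ?thesis by simp
  qed
  ultimately show ?thesis
    unfolding I_def by linarith
qed

text \<open>
  Applying \<open>inertia_le\<close> in both directions to \<open>p\<close> and to \<open>- p\<close> shows that the two diagonalizations have
  equally many positive, negative and zero entries, so that the signs agree up to a permutation.
\<close>

lemma sylvester_inertia:
  fixes p :: "'a::euclidean_space \<Rightarrow> 'a \<Rightarrow> real" and u v :: "'n::finite \<Rightarrow> 'a"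
  assumes p: "bilinear p"
    and u: "inj u" "independent (range u)" "\<And>i j. i \<noteq> j \<Longrightarrow> p (u i) (u j) = 0"
    and v: "inj v" "independent (range v)" "\<And>i j. i \<noteq> j \<Longrightarrow> p (v i) (v j) = 0"
    and dim: "DIM('a) = CARD('n)"
  obtains s where "s permutes UNIV" "\<And>i. sgn (p (v (s i)) (v (s i))) = sgn (p (u i) (u i))"
proof -
  have pos: "card {i. p (u i) (u i) > 0} = card {i. p (v i) (v i) > 0}"
    using inertia_le[OF p u v dim] inertia_le[OF p v u dim] by simp
  have "bilinear (\<lambda>x y. - p x y)"
    using p by (simp add: bilinear_def linear_compose_neg)
  note inertia_le[OF this u(1,2) _ v(1,2) _ dim] inertia_le[OF this v(1,2) _ u(1,2) _ dim]
  then have neg: "card {i. p (u i) (u i) < 0} = card {i. p (v i) (v i) < 0}"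
    using u(3) v(3) by simp
  have part: "card {i. f i = 0} + card {i. f i > 0} + card {i. f i < 0} = CARD('n)"
    for f :: "'n \<Rightarrow> real"
  proof -
    have "card {i. f i = 0} + card {i. f i > 0} + card {i. f i < 0} =
        card (({i. f i = 0} \<union> {i. f i > 0}) \<union> {i. f i < 0})"
      by (subst card_Un_disjoint, auto)+
    also have "({i. f i = 0} \<union> {i. f i > 0}) \<union> {i. f i < 0} = UNIV"
      by auto
    finally show ?thesis .
  qed
  have zero: "card {i. p (u i) (u i) = 0} = card {i. p (v i) (v i) = 0}"
    using part[of "\<lambda>i. p (u i) (u i)"] part[of "\<lambda>i. p (v i) (v i)"] pos neg by simp
  have "image_mset (\<lambda>i. sgn (p (u i) (u i))) (mset_set UNIV) = image_mset (\<lambda>i. sgn (p (v i) (v i))) (mset_set UNIV)"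
  proof (rule multiset_eqI)
    fix t :: real
    have cnt: "count (image_mset f (mset_set (UNIV :: 'n set))) t = card {i. f i = t}" for f
      by (simp add: count_image_mset vimage_def)
    have "sgn x = t \<longleftrightarrow> (t = 1 \<and> x > 0 \<or> t = 0 \<and> x = 0 \<or> t = -1 \<and> x < 0)" for x :: real
      by (auto simp: sgn_if)
    then show "count (image_mset (\<lambda>i. sgn (p (u i) (u i))) (mset_set UNIV)) t =
        count (image_mset (\<lambda>i. sgn (p (v i) (v i))) (mset_set UNIV)) t"
      unfolding cnt using pos neg zero
      by (cases "t = 1"; cases "t = 0"; cases "t = -1") simp_all
  qed
  from image_mset_eq_implies_permutes[OF finite this] obtain s where
    s: "s permutes UNIV" "\<forall>i\<in>UNIV. sgn (p (u i) (u i)) = sgn (p (v (s i)) (v (s i)))" .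
  show ?thesis
    by (rule that[OF s(1)]) (rule s(2)[THEN bspec, OF UNIV_I, symmetric])
qed

section \<open>Milnor bases orthogonal for a given metric\<close>

lemma is_basis_of_spanning:
  fixes u :: "3 \<Rightarrow> real ^ 3"
  assumes "span (range u) = UNIV"
  shows "is_basis u"
proof -
  have "dim (range u) = 3"
    using dim_span[of "range u"] unfolding assms by (simp add: dim_UNIV)
  moreover have "card (range u) \<le> 3"
    using card_image_le[of "UNIV :: 3 set" u] by simp
  ultimately have "card (range u) = 3" "independent (range u)"
    using dim_le_card[of "range u" "range u"] card_le_dim_spanning[of "range u" UNIV] assms
    by (auto simp: dim_UNIV span_superset)
  moreover from this have "inj u"
    by (intro eq_card_imp_inj_on) auto
  ultimately show ?thesis
    using assms by (simp add: is_basis_def)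
qed

lemma is_basis_lincomb:
  assumes V: "is_basis V" and u: "is_basis u"
  shows "is_basis (\<lambda>i. lincomb V (u i))"
proof -
  have inj: "inj (lincomb V)"
    using lincomb_inj[OF V] by (auto intro: injI)
  have range: "range (\<lambda>i. lincomb V (u i)) = lincomb V ` range u"
    by auto
  have "inj (\<lambda>i. lincomb V (u i))"
    using u inj by (auto simp: is_basis_def inj_def)
  moreover have "independent (lincomb V ` range u)"
    using u inj by (intro linear_independent_injective_image linear_lincomb)
      (auto simp: is_basis_def)
  moreover have "span (lincomb V ` range u) = UNIV"
  proof -
    have "span (lincomb V ` range u) = lincomb V ` UNIV"
      using u by (simp add: linear_span_image[OF linear_lincomb] is_basis_def)
    also have "\<dots> = UNIV"
      using lincomb_surj[OF V] by blast
    finally show ?thesis .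
  qed
  ultimately show ?thesis
    by (simp add: is_basis_def range)
qed

text \<open>
  In the coordinates of \<open>V\<close> the new vectors are multiples of the standard basis vectors; spanning is
  evident there, and three vectors that span \<open>\<real>\<^sup>3\<close> form a basis.
\<close>

lemma is_basis_permute_scale:
  assumes V: "is_basis V" and s: "s permutes UNIV" and c: "\<And>i. c i \<noteq> 0"
  shows "is_basis (\<lambda>i. c i *\<^sub>R V (s i))"
proof -
  define u :: "3 \<Rightarrow> real ^ 3" where "u i = c i *\<^sub>R axis (s i) 1" for i
  have ax: "axis j 1 \<in> span (range u)" for j
  proof -
    have "axis j 1 = (1 / c (inv s j)) *\<^sub>R u (inv s j)"
      using c permutes_surj[OF s] by (simp add: u_def surj_f_inv_f)
    then show ?thesis
      by (metis rangeI span_base span_scale)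
  qed
  have "x \<in> span (range u)" for x
  proof -
    have "x = (\<Sum>i\<in>UNIV. (x $ i) *\<^sub>R axis i 1)"
      by (simp add: basis_expansion scalar_mult_eq_scaleR[symmetric])
    then show ?thesis
      using ax by (metis (no_types, lifting) span_scale span_sum)
  qed
  then have "is_basis u"
    by (intro is_basis_of_spanning) auto
  from is_basis_lincomb[OF V this] show ?thesis
    by (simp add: u_def linear_scale[OF linear_lincomb])
qed

lemma orthogonal_metric_exists:
  assumes V: "is_basis V" and a: "\<And>i. a $ i > 0"
  obtains g where "riemannian_metric g"
    "\<And>x y. g (lincomb V x) (lincomb V y) = (\<Sum>i\<in>UNIV. a $ i * x $ i * y $ i)"
proof -
  define c where "c v = (THE x. v = lincomb V x)" for v
  have c: "c (lincomb V x) = x" for x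
    unfolding c_def using lincomb_inj[OF V] by blast
  have coord: "\<exists>x. v = lincomb V x" for v
    using lincomb_surj[OF V] by blast
  have lin: "c (v + w) = c v + c w" "c (r *\<^sub>R v) = r *\<^sub>R c v" for v w r
  proof -
    obtain x y where "v = lincomb V x" "w = lincomb V y"
      using coord by metis
    then show "c (v + w) = c v + c w" "c (r *\<^sub>R v) = r *\<^sub>R c v"
      by (simp_all only: c linear_add[OF linear_lincomb, symmetric] linear_scale[OF linear_lincomb, symmetric])
  qed
  define g where "g v w = (\<Sum>i\<in>UNIV. a $ i * c v $ i * c w $ i)" for v w
  have "riemannian_metric g"
    unfolding riemannian_metric_def
  proof (intro conjI allI impI)
    show "bilinear g"
      unfolding bilinear_def g_def
      by (intro conjI allI linearI) (simp_all add: lin sum.distrib[symmetric] sum_distrib_left algebra_simps)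
    show "g v w = g w v" for v w
      by (simp add: g_def mult_ac)
    show "g v v > 0" if "v \<noteq> 0" for v
    proof -
      obtain x where x: "v = lincomb V x" using coord by blast
      then have "x \<noteq> 0" using that linear_0[OF linear_lincomb] by metis
      then obtain i where i: "x $ i \<noteq> 0" by (auto simp: vec_eq_iff)
      have "0 < a $ i * x $ i * x $ i"
        using a[of i] i by (simp add: mult.assoc zero_less_mult_iff less_le)
      also have "\<dots> \<le> (\<Sum>i\<in>UNIV. a $ i * x $ i * x $ i)"
        by (rule member_le_sum) (use a in \<open>auto simp: mult.assoc less_imp_le\<close>)
      finally show ?thesis by (simp add: g_def x c)
    qed
  qed
  then show thesis
    by (rule that) (simp add: g_def c)
qed

lemma simultaneous_orthogonal_frame:
  fixes h q :: "real ^ 3 \<Rightarrow> real ^ 3 \<Rightarrow> real"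
  assumes h: "riemannian_metric h" and q: "bilinear q" "\<And>x y. q x y = q y x"
  obtains z :: "3 \<Rightarrow> real ^ 3" where "is_basis z"
    "\<And>i j. i \<noteq> j \<Longrightarrow> h (z i) (z j) = 0" "\<And>i j. i \<noteq> j \<Longrightarrow> q (z i) (z j) = 0"
proof -
  have h': "bilinear h" "\<And>x y. h x y = h y x" "\<And>x. x \<noteq> 0 \<Longrightarrow> h x x > 0"
    using h by (auto simp: riemannian_metric_def)
  obtain B where B: "independent B" "span B = (UNIV :: (real ^ 3) set)"
      "\<forall>x\<in>B. \<forall>y\<in>B. x \<noteq> y \<longrightarrow> h x y = 0 \<and> q x y = 0"
    using simultaneous_orthogonal_basis[OF h' q subspace_UNIV] by blast
  have fin: "finite B" using B(1) by (rule independent_imp_finite)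
  have "card B = dim (UNIV :: (real ^ 3) set)"
    using dim_eq_card[of B UNIV] B by simp
  then have "card (UNIV :: 3 set) = card B"
    by (simp add: dim_UNIV)
  then obtain z where z: "bij_betw z (UNIV :: 3 set) B"
    using finite_same_card_bij[OF finite fin] by blast
  then have zB: "z i \<in> B" and zinj: "i \<noteq> j \<Longrightarrow> z i \<noteq> z j" for i j
    by (auto simp: bij_betw_def inj_def)
  show thesis
  proof (rule that)
    show "is_basis z"
      using z B by (auto simp: is_basis_def bij_betw_def)
  qed (use zB zinj B(3) in blast)+
qed

text \<open>
  Here \<open>G\<close> is the Gram operator of a metric \<open>h\<close>, and the frame \<open>z\<close> is orthogonal for \<open>h\<close> and for
  \<open>Gx \<bullet> (l * Gy)\<close>.  The vector \<open>z i \<times> z j\<close> is perpendicular to \<open>z i\<close> and \<open>z j\<close>, as is \<open>G (z k)\<close>, so the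
  two are proportional.  Likewise \<open>l * G (z k)\<close> is \<open>h\<close>-orthogonal to \<open>z i\<close> and \<open>z j\<close>, so it is
  proportional to \<open>z k\<close>.  Together, the bracket of \<open>z i\<close> and \<open>z j\<close> is a multiple of \<open>z k\<close>, and the
  factors are found by testing against \<open>z k\<close>.
\<close>

lemma bracket_of_orthogonal_frame:
  fixes z :: "3 \<Rightarrow> real ^ 3" and G :: "real ^ 3 \<Rightarrow> real ^ 3"
  assumes z: "is_basis z"
    and G: "\<And>x y. x \<bullet> G y = y \<bullet> G x" "\<And>x. G x = 0 \<Longrightarrow> x = 0" "linear G"
    and pos: "\<And>i. z i \<bullet> G (z i) > 0"
    and orth: "\<And>i j. i \<noteq> j \<Longrightarrow> z i \<bullet> G (z j) = 0"
    and diag: "\<And>i j. i \<noteq> j \<Longrightarrow> G (z i) \<bullet> (\<chi> n. l $ n * G (z j) $ n) = 0"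
    and ijk: "(i, j, k) \<in> {(1, 2, 3), (2, 3, 1), (3, 1, 2)}"
  shows "(\<chi> n. l $ n * cross3 (z i) (z j) $ n) =
    (z 1 \<bullet> cross3 (z 2) (z 3) * (G (z k) \<bullet> (\<chi> n. l $ n * G (z k) $ n)) / (z k \<bullet> G (z k))\<^sup>2) *\<^sub>R z k"
proof -
  have eqI: "x = y" if "\<And>n. z n \<bullet> x = z n \<bullet> y" for x y
  proof -
    obtain c where c: "x - y = lincomb z c"
      using lincomb_surj[OF z] by blast
    have "(x - y) \<bullet> (x - y) = (\<Sum>n\<in>UNIV. c $ n * (z n \<bullet> (x - y)))"
      by (subst c) (simp add: lincomb_def inner_sum_left)
    also have "\<dots> = 0" using that by (simp add: inner_diff_right)
    finally show ?thesis by simp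
  qed
  have G_eqI: "x = y" if "\<And>n. G (z n) \<bullet> x = G (z n) \<bullet> y" for x y
  proof -
    have "z n \<bullet> G (x - y) = z n \<bullet> 0" for n
      using that[of n] G(1)[of "z n" "x - y"] by (simp add: inner_commute inner_diff_right)
    then have "G (x - y) = 0" by (rule eqI)
    then show ?thesis using G(2)[of "x - y"] by simp
  qed
  have ne: "i \<noteq> j" "j \<noteq> k" "i \<noteq> k" and cover: "n = i \<or> n = j \<or> n = k" for n
    using ijk exhaust_3[of n] by auto
  define d where "d = z 1 \<bullet> cross3 (z 2) (z 3)"
  define Q where "Q = G (z k) \<bullet> (\<chi> n. l $ n * G (z k) $ n)"
  define h where "h = z k \<bullet> G (z k)"
  have h: "h > 0" using pos by (simp add: h_def)
  have dk: "z k \<bullet> cross3 (z i) (z j) = d"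
    using ijk by (auto simp: d_def) (metis cross_triple inner_commute)+
  have "cross3 (z i) (z j) = (d / h) *\<^sub>R G (z k)"
  proof (rule eqI)
    fix n
    show "z n \<bullet> cross3 (z i) (z j) = z n \<bullet> ((d / h) *\<^sub>R G (z k))"
      using cover[of n] ne h orth[of i k] orth[of j k] dk
      by (auto simp: dot_cross_self h_def)
  qed
  moreover have "(\<chi> n. l $ n * G (z k) $ n) = (Q / h) *\<^sub>R z k"
  proof (rule G_eqI)
    fix n
    show "G (z n) \<bullet> (\<chi> n. l $ n * G (z k) $ n) = G (z n) \<bullet> ((Q / h) *\<^sub>R z k)"
      using cover[of n] ne h diag[of i k] diag[of j k] orth[of k i] orth[of k j]
      by (auto simp: Q_def h_def inner_commute[of _ "z k"])
  qed
  ultimately have "(\<chi> n. l $ n * cross3 (z i) (z j) $ n) = (d / h * (Q / h)) *\<^sub>R z k"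
    by (simp add: vec_eq_iff mult.left_commute)
  then show ?thesis
    by (simp add: d_def Q_def h_def power2_eq_square)
qed

lemma triple_product_nonzero:
  assumes z: "is_basis z"
  shows "z 1 \<bullet> cross3 (z 2) (z 3) \<noteq> (0 :: real)"
proof
  assume 0: "z 1 \<bullet> cross3 (z 2) (z 3) = 0"
  define w where "w = cross3 (z 2) (z 3)"
  obtain c where c: "w = lincomb z c"
    using lincomb_surj[OF z] by blast
  have "w \<bullet> w = (\<Sum>n\<in>UNIV. c $ n * (z n \<bullet> w))"
    by (subst c) (simp add: lincomb_def inner_sum_left)
  also have "\<dots> = 0"
    using 0 by (simp add: sum_3 w_def dot_cross_self)
  finally have "collinear {0, z 2, z 3}"
    by (simp add: w_def cross_eq_0)
  then obtain r where r: "z 2 = 0 \<or> z 3 = r *\<^sub>R z 2"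
    by (metis collinear_lemma scaleR_zero_left)
  have "lincomb z (axis 2 1) = lincomb z 0 \<or> lincomb z (axis 3 1) = lincomb z (r *\<^sub>R axis 2 1)"
    using r by (simp add: linear_0[OF linear_lincomb] linear_scale[OF linear_lincomb])
  then have "axis 2 (1 :: real) = (0 :: real ^ 3) \<or> axis 3 1 = r *\<^sub>R (axis 2 1 :: real ^ 3)"
    using lincomb_inj[OF z] by blast
  then show False
    by (auto simp: vec_eq_iff axis_def forall_3)
qed

text \<open>
  Milnor's theorem that a metric can be diagonalized by a basis with the given structure constants.  The
  structure constants of a simultaneously orthogonal frame \<open>z\<close> are, up to a positive factor, the values of
  the form \<open>p x y = x \<bullet> (l * y)\<close> on the basis \<open>G (z k)\<close> times the orientation sign of \<open>z\<close>.  The form has the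
  values \<open>l k\<close> on the standard basis, so that inertia, a permutation and a reversal of orientation give the
  right signs.
\<close>

lemma orthogonal_milnor_basis:
  fixes br :: "'a::real_vector \<Rightarrow> 'a \<Rightarrow> 'a"
  assumes br: "lie_bracket br" and V: "milnor_basis br l V" and g: "riemannian_metric g"
  obtains U where "milnor_basis br l U" "\<And>i j. i \<noteq> j \<Longrightarrow> g (U i) (U j) = 0"
proof -
  have basis: "is_basis V"
    using V by (simp add: milnor_basis_def)
  have g': "bilinear g" "\<And>x y. g x y = g y x" "\<And>x. x \<noteq> 0 \<Longrightarrow> g x x > 0"
    using g by (auto simp: riemannian_metric_def)
  define h where "h x y = g (lincomb V x) (lincomb V y)" for x y
  define G where "G y = (\<chi> i. h (axis i 1) y)" for y
  have bil_h: "bilinear h"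
    using g'(1) linear_lincomb[of V] unfolding bilinear_def h_def
    by (auto intro: linear_compose[unfolded o_def, of "lincomb V"])
  have h: "riemannian_metric h"
    unfolding riemannian_metric_def
  proof (intro conjI allI impI)
    show "h x y = h y x" for x y by (simp add: h_def g'(2))
    show "h x x > 0" if "x \<noteq> 0" for x
      unfolding h_def
    proof (rule g'(3))
      show "lincomb V x \<noteq> 0"
        using that lincomb_inj[OF basis, of x 0] linear_0[OF linear_lincomb, of V] by auto
    qed
  qed (rule bil_h)
  have hpos: "x \<noteq> 0 \<Longrightarrow> h x x > 0" and hsym: "h x y = h y x" for x y
    using h by (auto simp: riemannian_metric_def)
  have linG: "linear G"
    by (rule linearI) (simp_all add: G_def vec_eq_iff bilinear_radd[OF bil_h] bilinear_rmul[OF bil_h])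
  have hG: "x \<bullet> G y = h x y" for x y
  proof -
    have "h x y = h (\<Sum>i\<in>UNIV. (x $ i) *\<^sub>R axis i 1) y"
      by (simp add: basis_expansion scalar_mult_eq_scaleR[symmetric])
    also have "\<dots> = (\<Sum>i\<in>UNIV. x $ i * h (axis i 1) y)"
    proof -
      have "linear (\<lambda>x. h x y)" using bil_h by (simp add: bilinear_def)
      then show ?thesis
        using linear_sum[of "\<lambda>x. h x y" "\<lambda>i. (x $ i) *\<^sub>R axis i 1" UNIV] by (simp add: bilinear_lmul[OF bil_h])
    qed
    finally show ?thesis by (simp add: G_def inner_vec_def)
  qed
  have G0: "x = 0" if "G x = 0" for x
  proof (rule ccontr)
    assume "x \<noteq> 0"
    then show False using hG[of x x] hpos[of x] that by simp
  qed
  define p where "p x y = x \<bullet> (\<chi> n. l $ n * y $ n)" for x y :: "real ^ 3"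
  have p_sum: "p x y = (\<Sum>n\<in>UNIV. l $ n * x $ n * y $ n)" for x y
    by (simp add: p_def inner_vec_def mult_ac)
  have bil_p: "bilinear p"
    unfolding bilinear_def
    by (intro conjI allI linearI) (simp_all add: p_sum sum.distrib[symmetric] sum_distrib_left algebra_simps)
  have bil_q: "bilinear (\<lambda>x y. p (G x) (G y))"
    using bil_p linG unfolding bilinear_def
    by (auto intro: linear_compose[unfolded o_def, of G])
  have sym_q: "p (G x) (G y) = p (G y) (G x)" for x y
    by (simp add: p_sum mult_ac)
  obtain z0 where z0: "is_basis z0" "\<And>i j. i \<noteq> j \<Longrightarrow> h (z0 i) (z0 j) = 0"
    "\<And>i j. i \<noteq> j \<Longrightarrow> p (G (z0 i)) (G (z0 j)) = 0"
    using simultaneous_orthogonal_frame[OF h bil_q sym_q] by metis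
  have injG: "inj G"
    using G0 linear_injective_0[OF linG] by blast
  have axes: "inj (\<lambda>i. axis i (1 :: real) :: real ^ 3)" "independent (range (\<lambda>i. axis i (1 :: real) :: real ^ 3))"
  proof -
    show "inj (\<lambda>i. axis i (1 :: real) :: real ^ 3)"
      by (auto simp: inj_def axis_eq_axis)
    have "range (\<lambda>i. axis i (1 :: real) :: real ^ 3) \<subseteq> Basis"
      by (auto simp: axis_in_Basis_iff)
    then show "independent (range (\<lambda>i. axis i (1 :: real) :: real ^ 3))"
      using independent_Basis independent_mono by blast
  qed
  have Gz_inj: "inj (\<lambda>i. G (z0 i))"
    using injG z0(1) by (auto simp: inj_def is_basis_def)
  have Gz_indep: "independent (range (\<lambda>i. G (z0 i)))"
    using linear_independent_injective_image[OF linG, of "range z0"] z0(1) injG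
    by (simp add: is_basis_def image_image inj_on_subset)
  have axes_diag: "p (axis i 1) (axis j 1) = 0" if "i \<noteq> j" for i j
    unfolding p_sum using that by (intro sum.neutral) (simp add: axis_def)
  obtain s where s: "s permutes UNIV"
    "\<And>i. sgn (p (G (z0 (s i))) (G (z0 (s i)))) = sgn (p (axis i 1) (axis i 1))"
    by (rule sylvester_inertia[OF bil_p axes axes_diag Gz_inj Gz_indep z0(3)]) simp_all
  have paxis: "p (axis i 1) (axis i 1) = l $ i" for i
    by (simp add: p_sum axis_def if_distrib cong: if_cong)
  have sinj: "s i \<noteq> s j" if "i \<noteq> j" for i j
    using permutes_inj[OF s(1)] that by (simp add: inj_eq)
  \<comment> \<open>Multiplying all three vectors by \<open>e\<close> makes the frame positively oriented, since \<open>e\<^sup>3 = e\<close>.\<close>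
  define e where "e = sgn (z0 (s 1) \<bullet> cross3 (z0 (s 2)) (z0 (s 3)))"
  have zs: "is_basis (\<lambda>i. z0 (s i))"
    using is_basis_permute_scale[OF z0(1) s(1), of "\<lambda>_. 1"] by simp
  have e: "e \<noteq> 0" "e * e = 1"
    using triple_product_nonzero[OF zs] by (auto simp: e_def sgn_if)
  define z where "z i = e *\<^sub>R z0 (s i)" for i
  have z: "is_basis z"
    unfolding z_def by (rule is_basis_permute_scale[OF z0(1) s(1)]) (rule e(1))
  define d where "d = z 1 \<bullet> cross3 (z 2) (z 3)"
  have "d = (e * e) * (e * (z0 (s 1) \<bullet> cross3 (z0 (s 2)) (z0 (s 3))))"
    by (simp add: d_def z_def cross_mult_left cross_mult_right)
  also have "\<dots> = \<bar>z0 (s 1) \<bullet> cross3 (z0 (s 2)) (z0 (s 3))\<bar>"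
    unfolding e by (simp add: e_def abs_sgn mult.commute)
  finally have d: "d > 0"
    using triple_product_nonzero[OF zs] by simp
  have zpos: "h (z i) (z i) > 0" for i
  proof (rule hpos)
    show "z i \<noteq> 0" using z by (rule is_basis_nonzero)
  qed
  have zorth: "h (z i) (z j) = 0" if "i \<noteq> j" for i j
    using z0(2)[OF sinj[OF that]] by (simp add: z_def bilinear_lmul[OF bil_h] bilinear_rmul[OF bil_h])
  have zdiag: "p (G (z i)) (G (z j)) = 0" if "i \<noteq> j" for i j
    using z0(3)[OF sinj[OF that]]
    by (simp add: z_def linear_scale[OF linG] bilinear_lmul[OF bil_p] bilinear_rmul[OF bil_p])
  have "p (G (z i)) (G (z i)) = e * e * p (G (z0 (s i))) (G (z0 (s i)))" for i
    by (simp add: z_def linear_scale[OF linG] bilinear_lmul[OF bil_p] bilinear_rmul[OF bil_p])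
  then have zsgn: "sgn (p (G (z i)) (G (z i))) = sgn (l $ i)" for i
    using s(2)[of i] by (simp add: e paxis)
  define m where "m k = d * p (G (z k)) (G (z k)) / (h (z k) (z k))\<^sup>2" for k
  have msgn: "sgn (m k) = sgn (l $ k)" for k
    using d zpos[of k] zsgn[of k] by (simp add: m_def sgn_mult sgn_divide)
  have bracket: "(\<chi> n. l $ n * cross3 (z i) (z j) $ n) = m k *\<^sub>R z k"
    if "(i, j, k) \<in> {(1, 2, 3), (2, 3, 1), (3, 1, 2)}" for i j k
  proof -
    note * = bracket_of_orthogonal_frame[OF z _ G0 linG _ _ _ that, of l, unfolded hG, folded p_def d_def]
    show ?thesis
      unfolding m_def by (rule *) (simp_all add: hsym zpos zorth zdiag)
  qed
  \<comment> \<open>If \<open>l k = 0\<close>, then \<open>m k = 0\<close> and any positive number serves as \<open>r k\<close>.\<close>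
  define r where "r k = (if l $ k = 0 then 1 else l $ k / m k)" for k
  have r: "r k > 0" "r k * m k = l $ k" for k
    using msgn[of k] by (auto simp: r_def sgn_if zero_less_divide_iff split: if_splits)
  \<comment> \<open>Scaling \<open>z i\<close> by \<open>c i\<close> multiplies the \<open>k\<close>-th structure constant by \<open>c i * c j / c k\<close>, which is to be \<open>r k\<close>.\<close>
  define c where "c = (\<lambda>i :: 3. if i = 1 then sqrt (r 2 * r 3) else if i = 2 then sqrt (r 3 * r 1) else sqrt (r 1 * r 2))"
  have cpos: "c i \<noteq> 0" for i
    using r(1)[of 1] r(1)[of 2] r(1)[of 3] by (simp add: c_def)
  have ccc: "c i * c j = r k * c k" if "(i, j, k) \<in> {(1, 2, 3), (2, 3, 1), (3, 1, 2)}" for i j k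
    using that r(1)[of 1] r(1)[of 2] r(1)[of 3]
    by (auto simp: c_def real_sqrt_mult mult_ac)
  define U where "U i = lincomb V (c i *\<^sub>R z i)" for i
  have "is_basis (\<lambda>i. c i *\<^sub>R z i)"
    using is_basis_permute_scale[OF z permutes_id cpos] by simp
  then have "is_basis U"
    unfolding U_def by (rule is_basis_lincomb[OF basis])
  moreover have "br (U i) (U j) = (l $ k) *\<^sub>R U k"
    if "(i, j, k) \<in> {(1, 2, 3), (2, 3, 1), (3, 1, 2)}" for i j k
  proof -
    have "br (U i) (U j) = lincomb V ((c i * c j) *\<^sub>R (\<chi> n. l $ n * cross3 (z i) (z j) $ n))"
      unfolding U_def milnor_basis_lincomb[OF br V]
      by (rule arg_cong[of _ _ "lincomb V"]) (simp add: vec_eq_iff cross_mult_left cross_mult_right mult_ac)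
    also have "\<dots> = lincomb V ((l $ k) *\<^sub>R (c k *\<^sub>R z k))"
      unfolding bracket[OF that] ccc[OF that] r(2)[of k, symmetric] by (simp add: mult_ac)
    finally show ?thesis
      by (simp add: U_def linear_scale[OF linear_lincomb])
  qed
  ultimately have "milnor_basis br l U"
    unfolding milnor_basis_iff[OF br] by simp
  moreover have "g (U i) (U j) = 0" if "i \<noteq> j" for i j
    using zorth[OF that] unfolding U_def h_def[symmetric]
    by (simp add: bilinear_lmul[OF bil_h] bilinear_rmul[OF bil_h])
  ultimately show thesis by (rule that)
qed

section \<open>Reduction to three equations for the diagonal components\<close>

text \<open>
  Solvability of the prescribed Ricci curvature equation among the metrics that are diagonal in a fixed
  Milnor basis: \<open>a\<^sub>1, a\<^sub>2, a\<^sub>3\<close> are the diagonal entries of the metric and \<open>c\<close> is the constant.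
\<close>

definition realizable :: "real \<Rightarrow> real \<Rightarrow> real \<Rightarrow> real \<Rightarrow> real \<Rightarrow> real \<Rightarrow> bool" where
  "realizable l1 l2 l3 T1 T2 T3 \<longleftrightarrow> (\<exists>a1 a2 a3 c. a1 > 0 \<and> a2 > 0 \<and> a3 > 0 \<and> c > 0 \<and>
     principal_ricci l1 l2 l3 a1 a2 a3 = c * T1 \<and>
     principal_ricci l2 l3 l1 a2 a3 a1 = c * T2 \<and>
     principal_ricci l3 l1 l2 a3 a1 a2 = c * T3)"

text \<open>
  A polynomial form of the equations, obtained with \<open>k = 1 / (2 a\<^sub>1 a\<^sub>2 a\<^sub>3 c)\<close>: the constant \<open>c\<close> is free, so
  \<open>k\<close> is an arbitrary positive number.
\<close>

lemma realizable_iff: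
  "realizable l1 l2 l3 T1 T2 T3 \<longleftrightarrow> (\<exists>a1 a2 a3 k. a1 > 0 \<and> a2 > 0 \<and> a3 > 0 \<and> k > 0 \<and>
     T1 = k * a1 * (l3 * a3 + l1 * a1 - l2 * a2) * (l1 * a1 + l2 * a2 - l3 * a3) \<and>
     T2 = k * a2 * (l1 * a1 + l2 * a2 - l3 * a3) * (l2 * a2 + l3 * a3 - l1 * a1) \<and>
     T3 = k * a3 * (l2 * a2 + l3 * a3 - l1 * a1) * (l3 * a3 + l1 * a1 - l2 * a2))"
    (is "_ \<longleftrightarrow> ?rhs")
proof
  assume "realizable l1 l2 l3 T1 T2 T3"
  then obtain a1 a2 a3 c where *: "a1 > 0" "a2 > 0" "a3 > 0" "c > 0"
     "principal_ricci l1 l2 l3 a1 a2 a3 = c * T1"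
     "principal_ricci l2 l3 l1 a2 a3 a1 = c * T2"
     "principal_ricci l3 l1 l2 a3 a1 a2 = c * T3"
    by (auto simp: realizable_def)
  have T: "T1 = principal_ricci l1 l2 l3 a1 a2 a3 / c"
    "T2 = principal_ricci l2 l3 l1 a2 a3 a1 / c"
    "T3 = principal_ricci l3 l1 l2 a3 a1 a2 / c"
    using * by (simp_all add: field_simps)
  show ?rhs
    unfolding T principal_ricci_def
    by (rule exI[of _ a1], rule exI[of _ a2], rule exI[of _ a3], rule exI[of _ "1 / (2 * a1 * a2 * a3 * c)"])
      (use *(1-4) in simp)
next
  assume ?rhs
  then obtain a1 a2 a3 k where *: "a1 > 0" "a2 > 0" "a3 > 0" "k > 0"
     "T1 = k * a1 * (l3 * a3 + l1 * a1 - l2 * a2) * (l1 * a1 + l2 * a2 - l3 * a3)"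
     "T2 = k * a2 * (l1 * a1 + l2 * a2 - l3 * a3) * (l2 * a2 + l3 * a3 - l1 * a1)"
     "T3 = k * a3 * (l2 * a2 + l3 * a3 - l1 * a1) * (l3 * a3 + l1 * a1 - l2 * a2)"
    by blast
  show "realizable l1 l2 l3 T1 T2 T3"
    unfolding realizable_def *(5-7) principal_ricci_def
    by (rule exI[of _ a1], rule exI[of _ a2], rule exI[of _ a3], rule exI[of _ "1 / (2 * a1 * a2 * a3 * k)"])
      (use *(1-4) in simp)
qed

lemma realizableI:
  assumes "a1 > 0" "a2 > 0" "a3 > 0" "k > 0"
     "T1 = k * a1 * (l3 * a3 + l1 * a1 - l2 * a2) * (l1 * a1 + l2 * a2 - l3 * a3)"
     "T2 = k * a2 * (l1 * a1 + l2 * a2 - l3 * a3) * (l2 * a2 + l3 * a3 - l1 * a1)"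
     "T3 = k * a3 * (l2 * a2 + l3 * a3 - l1 * a1) * (l3 * a3 + l1 * a1 - l2 * a2)"
  shows "realizable l1 l2 l3 T1 T2 T3"
  unfolding realizable_iff using assms by blast

lemma realizable_swap12:
  assumes "realizable l1 l2 l3 T1 T2 T3"
  shows "realizable l2 l1 l3 T2 T1 T3"
proof -
  obtain a1 a2 a3 k where "a1 > 0" "a2 > 0" "a3 > 0" "k > 0"
     "T1 = k * a1 * (l3 * a3 + l1 * a1 - l2 * a2) * (l1 * a1 + l2 * a2 - l3 * a3)"
     "T2 = k * a2 * (l1 * a1 + l2 * a2 - l3 * a3) * (l2 * a2 + l3 * a3 - l1 * a1)"
     "T3 = k * a3 * (l2 * a2 + l3 * a3 - l1 * a1) * (l3 * a3 + l1 * a1 - l2 * a2)"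
    using assms unfolding realizable_iff by blast
  then show ?thesis
    by (intro realizableI[of a2 a1 a3 k]) (simp_all add: algebra_simps)
qed

lemma realizable_swap23:
  assumes "realizable l1 l2 l3 T1 T2 T3"
  shows "realizable l1 l3 l2 T1 T3 T2"
proof -
  obtain a1 a2 a3 k where "a1 > 0" "a2 > 0" "a3 > 0" "k > 0"
     "T1 = k * a1 * (l3 * a3 + l1 * a1 - l2 * a2) * (l1 * a1 + l2 * a2 - l3 * a3)"
     "T2 = k * a2 * (l1 * a1 + l2 * a2 - l3 * a3) * (l2 * a2 + l3 * a3 - l1 * a1)"
     "T3 = k * a3 * (l2 * a2 + l3 * a3 - l1 * a1) * (l3 * a3 + l1 * a1 - l2 * a2)"
    using assms unfolding realizable_iff by blast
  then show ?thesis
    by (intro realizableI[of a1 a3 a2 k]) (simp_all add: algebra_simps)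
qed

text \<open>
  From left to right, the Milnor basis is chosen orthogonal for the given metric, which makes the Ricci
  form, and hence \<open>T\<close>, diagonal in it.  From right to left, the metric is defined to be diagonal in the given
  basis, with the \<open>a\<^sub>i\<close> as its diagonal entries.
\<close>

lemma prescribed_ricci_iff_realizable:
  fixes br :: "'a::real_vector \<Rightarrow> 'a \<Rightarrow> 'a"
  assumes dim: "dim (UNIV :: 'a set) = 3" and br: "lie_bracket br" and V0: "milnor_basis br l V0"
    and T: "bilinear T"
  shows "(\<exists>g c. riemannian_metric g \<and> c > 0 \<and> (\<forall>x y. ricci br g x y = c * T x y)) \<longleftrightarrow>
    (\<exists>V. milnor_basis br l V \<and> (\<forall>i j. i \<noteq> j \<longrightarrow> T (V i) (V j) = 0) \<and>
       realizable (l $ 1) (l $ 2) (l $ 3) (T (V 1) (V 1)) (T (V 2) (V 2)) (T (V 3) (V 3)))"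
proof
  assume "\<exists>g c. riemannian_metric g \<and> c > 0 \<and> (\<forall>x y. ricci br g x y = c * T x y)"
  then obtain g c where g: "riemannian_metric g" and c: "c > 0" and eq: "\<And>x y. ricci br g x y = c * T x y"
    by blast
  obtain V where V: "milnor_basis br l V" "\<And>i j. i \<noteq> j \<Longrightarrow> g (V i) (V j) = 0"
    using orthogonal_milnor_basis[OF br V0 g] by blast
  define a where "a = (\<chi> i. g (V i) (V i))"
  have a: "a $ i = g (V i) (V i)" for i
    by (simp add: a_def)
  have pos: "a $ i > 0" for i
    using g V(1) is_basis_nonzero[of V i] by (simp add: a riemannian_metric_def milnor_basis_def)
  note R = milnor_frame_ricci[OF dim br V(1) g V(2) a]
  have T_V: "c * T (V i) (V j) =
     principal_ricci (l $ 1) (l $ 2) (l $ 3) (a $ 1) (a $ 2) (a $ 3) * axis i 1 $ 1 * axis j 1 $ 1 +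
     principal_ricci (l $ 2) (l $ 3) (l $ 1) (a $ 2) (a $ 3) (a $ 1) * axis i 1 $ 2 * axis j 1 $ 2 +
     principal_ricci (l $ 3) (l $ 1) (l $ 2) (a $ 3) (a $ 1) (a $ 2) * axis i 1 $ 3 * axis j 1 $ 3" for i j
    using R[of "axis i 1" "axis j 1"] by (simp add: eq)
  have "T (V i) (V j) = 0" if "i \<noteq> j" for i j
  proof -
    have "c * T (V i) (V j) = 0"
      unfolding T_V using that by (auto simp: axis_def)
    then show ?thesis using c by simp
  qed
  moreover have "realizable (l $ 1) (l $ 2) (l $ 3) (T (V 1) (V 1)) (T (V 2) (V 2)) (T (V 3) (V 3))"
    unfolding realizable_def
    by (rule exI[of _ "a $ 1"], rule exI[of _ "a $ 2"], rule exI[of _ "a $ 3"], rule exI[of _ c])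
      (simp add: pos c T_V axis_def)
  ultimately show "\<exists>V. milnor_basis br l V \<and> (\<forall>i j. i \<noteq> j \<longrightarrow> T (V i) (V j) = 0) \<and>
       realizable (l $ 1) (l $ 2) (l $ 3) (T (V 1) (V 1)) (T (V 2) (V 2)) (T (V 3) (V 3))"
    using V(1) by blast
next
  assume "\<exists>V. milnor_basis br l V \<and> (\<forall>i j. i \<noteq> j \<longrightarrow> T (V i) (V j) = 0) \<and>
       realizable (l $ 1) (l $ 2) (l $ 3) (T (V 1) (V 1)) (T (V 2) (V 2)) (T (V 3) (V 3))"
  then obtain V where V: "milnor_basis br l V" "\<And>i j. i \<noteq> j \<Longrightarrow> T (V i) (V j) = 0"
    and real: "realizable (l $ 1) (l $ 2) (l $ 3) (T (V 1) (V 1)) (T (V 2) (V 2)) (T (V 3) (V 3))"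
    by blast
  have basis: "is_basis V"
    using V(1) by (simp add: milnor_basis_def)
  obtain a1 a2 a3 c where pos: "a1 > 0" "a2 > 0" "a3 > 0" "c > 0"
    and ric: "principal_ricci (l $ 1) (l $ 2) (l $ 3) a1 a2 a3 = c * T (V 1) (V 1)"
      "principal_ricci (l $ 2) (l $ 3) (l $ 1) a2 a3 a1 = c * T (V 2) (V 2)"
      "principal_ricci (l $ 3) (l $ 1) (l $ 2) a3 a1 a2 = c * T (V 3) (V 3)"
    using real unfolding realizable_def by blast
  define a :: "real ^ 3" where "a = vector [a1, a2, a3]"
  have a_nth: "a $ 1 = a1" "a $ 2 = a2" "a $ 3 = a3"
    by (simp_all add: a_def)
  have apos: "a $ i > 0" for i
    using exhaust_3[of i] pos by (auto simp: a_nth)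
  obtain g where g: "riemannian_metric g"
    "\<And>x y. g (lincomb V x) (lincomb V y) = (\<Sum>i\<in>UNIV. a $ i * x $ i * y $ i)"
    using orthogonal_metric_exists[OF basis apos] by blast
  have g_V: "g (V i) (V j) = (if i = j then a $ i else 0)" for i j
  proof -
    have "g (V i) (V j) = (\<Sum>n\<in>UNIV. a $ n * axis i 1 $ n * axis j 1 $ n)"
      using g(2)[of "axis i 1" "axis j 1"] by simp
    also have "\<dots> = (\<Sum>n\<in>UNIV. if n = i then (if i = j then a $ i else 0) else 0)"
      by (intro sum.cong) (auto simp: axis_def)
    finally show ?thesis by simp
  qed
  have orth: "\<And>i j. i \<noteq> j \<Longrightarrow> g (V i) (V j) = 0" and diag: "\<And>i. a $ i = g (V i) (V i)"
    by (simp_all add: g_V)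
  note R = milnor_frame_ricci[OF dim br V(1) g(1) orth diag, unfolded a_nth ric]
  have "ricci br g v w = c * T v w" for v w
  proof -
    obtain x y where "v = lincomb V x" "w = lincomb V y"
      using lincomb_surj[OF basis] by metis
    then show ?thesis
      by (simp add: R bilinear_lincomb[OF T] sum_3 V(2) algebra_simps)
  qed
  then show "\<exists>g c. riemannian_metric g \<and> c > 0 \<and> (\<forall>x y. ricci br g x y = c * T x y)"
    using g(1) pos(4) by blast
qed

section \<open>Groups with a vanishing structure constant\<close>

lemma R3_realizable_iff: "realizable 0 0 0 T1 T2 T3 \<longleftrightarrow> R3_constraint T1 T2 T3"
  by (auto simp: realizable_iff R3_constraint_def intro!: exI[of _ "1::real"])

text \<open>
  In each of the following cases the conditions are necessary because of the signs of the three products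
  and of the sum \<open>T\<^sub>1 + T\<^sub>2\<close>.  For the converse, positive numbers \<open>a\<^sub>1, a\<^sub>2, a\<^sub>3, k\<close> are given explicitly.
\<close>

lemma H3_realizable_iff: "realizable 2 0 0 T1 T2 T3 \<longleftrightarrow> H3_constraint T1 T2 T3"
proof
  assume "realizable 2 0 0 T1 T2 T3"
  then show "H3_constraint T1 T2 T3"
    by (auto simp: realizable_iff H3_constraint_def)
next
  assume T: "H3_constraint T1 T2 T3"
  then have s: "T1 > 0" "T2 < 0" "T3 < 0"
    by (auto simp: H3_constraint_def)
  show "realizable 2 0 0 T1 T2 T3"
    using s by (intro realizableI[of 1 "- T2 / T1" "- T3 / T1" "T1 / 4"]) (simp_all add: field_simps)
qed

lemma E2_realizable_iff: "realizable 2 2 0 T1 T2 T3 \<longleftrightarrow> E2_constraint T1 T2 T3"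
proof
  assume "realizable 2 2 0 T1 T2 T3"
  then obtain a1 a2 a3 k where a: "a1 > 0" "a2 > 0" "a3 > 0" "k > 0"
    and T: "T1 = k * a1 * (2 * a1 - 2 * a2) * (2 * a1 + 2 * a2)"
     "T2 = k * a2 * (2 * a1 + 2 * a2) * (2 * a2 - 2 * a1)"
     "T3 = k * a3 * (2 * a2 - 2 * a1) * (2 * a1 - 2 * a2)"
    unfolding realizable_iff by auto
  have sum: "T1 + T2 = 4 * k * (a1 + a2) * (a1 - a2)\<^sup>2"
    unfolding T by (simp add: power2_eq_square algebra_simps)
  consider "a1 = a2" | "a1 < a2" | "a1 > a2" by linarith
  then show "E2_constraint T1 T2 T3"
  proof cases
    case 1
    then show ?thesis by (simp add: T E2_constraint_def)
  next
    case 2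
    then have "T1 + T2 > 0" using a by (simp add: sum)
    moreover have "T1 < 0" "T2 > 0" "T3 < 0"
      using 2 a unfolding T by (simp_all add: mult_pos_neg mult_neg_pos mult_pos_pos)
    ultimately show ?thesis by (simp add: E2_constraint_def)
  next
    case 3
    then have "T1 + T2 > 0" using a by (simp add: sum)
    moreover have "T1 > 0" "T2 < 0" "T3 < 0"
      using 3 a unfolding T by (simp_all add: mult_pos_neg mult_neg_pos mult_pos_pos)
    ultimately show ?thesis by (simp add: E2_constraint_def)
  qed
next
  \<comment> \<open>The equations imply \<open>a1 / a2 = - T1 / T2\<close>, which suggests \<open>a1 = T1\<close> and \<open>a2 = - T2\<close>.
    The first and the third equation then determine \<open>k\<close> and \<open>a3\<close>.\<close>
  have main: "realizable 2 2 0 T1 T2 T3" if "T1 > 0" "T2 < 0" "T3 < 0" "T1 + T2 > 0" for T1 T2 T3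
  proof (rule realizableI)
    define k where "k = 1 / (4 * (T1 + T2) * (T1 - T2))"
    show "T1 > 0" "- T2 > 0" "- T3 * (T1 - T2) / (T1 + T2) > 0" "k > 0"
      using that by (simp_all add: k_def divide_neg_pos mult_neg_pos)
    show "T1 = k * T1 * (0 * (- T3 * (T1 - T2) / (T1 + T2)) + 2 * T1 - 2 * - T2) *
        (2 * T1 + 2 * - T2 - 0 * (- T3 * (T1 - T2) / (T1 + T2)))"
      "T2 = k * - T2 * (2 * T1 + 2 * - T2 - 0 * (- T3 * (T1 - T2) / (T1 + T2))) *
        (2 * - T2 + 0 * (- T3 * (T1 - T2) / (T1 + T2)) - 2 * T1)"
      "T3 = k * (- T3 * (T1 - T2) / (T1 + T2)) * (2 * - T2 + 0 * (- T3 * (T1 - T2) / (T1 + T2)) - 2 * T1) *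
        (0 * (- T3 * (T1 - T2) / (T1 + T2)) + 2 * T1 - 2 * - T2)"
      using that by (simp_all add: k_def divide_simps, (simp add: algebra_simps)+)
  qed
  assume "E2_constraint T1 T2 T3"
  then consider "T1 = 0 \<and> T2 = 0 \<and> T3 = 0" | "T1 > 0 \<and> T2 < 0 \<and> T3 < 0 \<and> T1 + T2 > 0"
    | "T2 > 0 \<and> T1 < 0 \<and> T3 < 0 \<and> T1 + T2 > 0"
    by (auto simp: E2_constraint_def)
  then show "realizable 2 2 0 T1 T2 T3"
  proof cases
    case 1
    then show ?thesis by (intro realizableI[of 1 1 1 1]) auto
  next
    case 2
    then show ?thesis by (auto intro: main)
  next
    case 3
    have "realizable 2 2 0 T2 T1 T3"
      by (rule main) (use 3 in auto)
    then show ?thesis by (rule realizable_swap12)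
  qed
qed

lemma E11_realizable_iff: "realizable 2 (- 2) 0 T1 T2 T3 \<longleftrightarrow> E11_constraint T1 T2 T3"
proof
  assume "realizable 2 (- 2) 0 T1 T2 T3"
  then obtain a1 a2 a3 k where a: "a1 > 0" "a2 > 0" "a3 > 0" "k > 0"
    and T: "T1 = k * a1 * (2 * a1 + 2 * a2) * (2 * a1 - 2 * a2)"
     "T2 = k * a2 * (2 * a1 - 2 * a2) * (- 2 * a2 - 2 * a1)"
     "T3 = k * a3 * (- 2 * a2 - 2 * a1) * (2 * a1 + 2 * a2)"
    unfolding realizable_iff by auto
  have sum: "T1 + T2 = 4 * k * (a1 + a2) * (a1 - a2)\<^sup>2"
    unfolding T by (simp add: power2_eq_square algebra_simps)
  have T3: "T3 < 0"
    unfolding T by (rule mult_neg_pos[OF mult_pos_neg]) (use a in auto)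
  consider "a1 = a2" | "a1 < a2" | "a1 > a2" by linarith
  then show "E11_constraint T1 T2 T3"
  proof cases
    case 1
    then show ?thesis using T3 by (simp add: T(1,2) E11_constraint_def)
  next
    case 2
    then have "T1 + T2 > 0" using a by (simp add: sum)
    moreover have "T1 < 0"
      using 2 a unfolding T by (intro mult_pos_neg mult_pos_pos) auto
    ultimately show ?thesis using T3 by (simp add: E11_constraint_def)
  next
    case 3
    then have "T1 + T2 > 0" using a by (simp add: sum)
    moreover have "T2 < 0"
      using 3 a unfolding T by (intro mult_pos_neg mult_pos_pos) auto
    ultimately show ?thesis using T3 by (simp add: E11_constraint_def)
  qed
next
  \<comment> \<open>As for \<open>l = (2, 2, 0)\<close>, the ratio of the first two equations suggests \<open>a1 = T1\<close> and \<open>a2 = - T2\<close>.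
    The statement leaves open which of the two basis vectors \<open>a1\<close> belongs to, so as to serve both sign patterns.\<close>
  have main: "\<exists>a1 a2 a3 k. a1 > 0 \<and> a2 > 0 \<and> a3 > 0 \<and> k > 0 \<and>
      T1 = 4 * k * a1 * (a1 + a2) * (a1 - a2) \<and> T2 = - 4 * k * a2 * (a1 + a2) * (a1 - a2) \<and>
      T3 = - 4 * k * a3 * (a1 + a2) * (a1 + a2)"
    if "T1 > 0" "T2 < 0" "T3 < 0" "T1 + T2 > 0" for T1 T2 T3 :: real
  proof (rule exI[of _ T1], rule exI[of _ "- T2"], rule exI[of _ "- T3 * (T1 + T2) / (T1 - T2)"],
      rule exI[of _ "1 / (4 * (T1 + T2) * (T1 - T2))"], intro conjI)
    show "T1 > 0" "- T2 > 0" "- T3 * (T1 + T2) / (T1 - T2) > 0" "1 / (4 * (T1 + T2) * (T1 - T2)) > 0"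
      using that by (simp_all add: divide_neg_pos mult_neg_pos)
    define x y where "x = T1 + T2" "y = T1 - T2"
    have "x \<noteq> 0" "y \<noteq> 0" "T1 + - T2 = y" "T1 - - T2 = x"
      using that by (auto simp: x_y_def)
    then show "T1 = 4 * (1 / (4 * (T1 + T2) * (T1 - T2))) * T1 * (T1 + - T2) * (T1 - - T2)"
      "T2 = - 4 * (1 / (4 * (T1 + T2) * (T1 - T2))) * - T2 * (T1 + - T2) * (T1 - - T2)"
      "T3 = - 4 * (1 / (4 * (T1 + T2) * (T1 - T2))) * (- T3 * (T1 + T2) / (T1 - T2)) * (T1 + - T2) * (T1 + - T2)"
      unfolding x_y_def(1)[symmetric] x_y_def(2)[symmetric] by simp_all
  qed
  assume "E11_constraint T1 T2 T3"
  then consider "T1 = 0 \<and> T2 = 0 \<and> T3 < 0" | "T1 > 0 \<and> T2 < 0 \<and> T3 < 0 \<and> T1 + T2 > 0"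
    | "T2 > 0 \<and> T1 < 0 \<and> T3 < 0 \<and> T1 + T2 > 0"
    by (auto simp: E11_constraint_def)
  then show "realizable 2 (- 2) 0 T1 T2 T3"
  proof cases
    case 1
    then show ?thesis by (intro realizableI[of 1 1 1 "- T3 / 16"]) auto
  next
    case 2
    then obtain a1 a2 a3 k where *: "a1 > 0" "a2 > 0" "a3 > 0" "k > 0"
      "T1 = 4 * k * a1 * (a1 + a2) * (a1 - a2)" "T2 = - 4 * k * a2 * (a1 + a2) * (a1 - a2)"
      "T3 = - 4 * k * a3 * (a1 + a2) * (a1 + a2)"
      using main[of T1 T2 T3] by blast
    show ?thesis unfolding *(5-7)
      by (intro realizableI[of a1 a2 a3 k]) (use * in \<open>simp_all add: algebra_simps\<close>)
  next
    case 3
    then obtain a1 a2 a3 k where *: "a1 > 0" "a2 > 0" "a3 > 0" "k > 0"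
      "T2 = 4 * k * a1 * (a1 + a2) * (a1 - a2)" "T1 = - 4 * k * a2 * (a1 + a2) * (a1 - a2)"
      "T3 = - 4 * k * a3 * (a1 + a2) * (a1 + a2)"
      using main[of T2 T1 T3] by (metis add.commute)
    show ?thesis unfolding *(5-7)
      by (intro realizableI[of a2 a1 a3 k]) (use * in \<open>simp_all add: algebra_simps\<close>)
  qed
qed

section \<open>Groups with nonzero structure constants: a cubic equation\<close>

text \<open>
  For \<open>l = (2, 2, 2)\<close> and \<open>U = T\<close> this is the polynomial in the constraint for \<open>SO(3)\<close>.  For nonzero \<open>p\<close>
  with \<open>U\<^sub>i + p \<noteq> 0\<close>, it vanishes if and only if \<open>p/(U\<^sub>1 + p) + p/(U\<^sub>2 + p) + p/(U\<^sub>3 + p) = 1\<close>.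
\<close>

definition ricci_cubic :: "real \<Rightarrow> real \<Rightarrow> real \<Rightarrow> real \<Rightarrow> real" where
  "ricci_cubic U1 U2 U3 p = 2 * p ^ 3 + (U1 + U2 + U3) * p\<^sup>2 - U1 * U2 * U3"

lemma continuous_on_ricci_cubic: "continuous_on A (ricci_cubic U1 U2 U3)"
  unfolding ricci_cubic_def by (intro continuous_intros)

text \<open>
  Put \<open>U\<^sub>i = e\<^sub>i T\<^sub>i\<close> and \<open>b\<^sub>i = e\<^sub>i a\<^sub>i\<close>, so that \<open>y\<^sub>i = l\<^sub>i a\<^sub>i = 2 b\<^sub>i\<close>, and let
  \<open>Q\<^sub>1 = b\<^sub>2 + b\<^sub>3 - b\<^sub>1\<close>, cyclically.  The equations to solve become \<open>U\<^sub>i = \<kappa> b\<^sub>i Q\<^sub>j Q\<^sub>k\<close>.  With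
  \<open>p = \<kappa> Q\<^sub>1 Q\<^sub>2 Q\<^sub>3 / 2\<close> they read \<open>U\<^sub>i / p = 2 b\<^sub>i / Q\<^sub>i = (Q\<^sub>j + Q\<^sub>k) / Q\<^sub>i\<close>, that is,
  \<open>(U\<^sub>i + p) / p = (Q\<^sub>1 + Q\<^sub>2 + Q\<^sub>3) / Q\<^sub>i\<close>.  Up to scaling this leaves \<open>Q\<^sub>i = s / (U\<^sub>i + p)\<close> with a sign \<open>s\<close>,
  consistent exactly when \<open>p\<close> is a root of the cubic, and then \<open>b\<^sub>i = Q\<^sub>i U\<^sub>i / (2 p)\<close>.  The sign
  hypotheses on the \<open>s p T\<^sub>i (U\<^sub>i + p)\<close> say that the \<open>a\<^sub>i\<close> are positive, and together with
  \<open>T\<^sub>1 T\<^sub>2 T\<^sub>3 > 0\<close> they make the proportionality factor \<open>k\<close> positive.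
\<close>

lemma ricci_cubic_root_realizable:
  assumes e: "e1 \<in> {1, - 1}" "e2 \<in> {1, - 1}" "e3 \<in> {1, - 1}" and s: "s \<in> {1, - 1}"
    and root: "ricci_cubic (e1 * T1) (e2 * T2) (e3 * T3) p = 0"
    and prod: "T1 * T2 * T3 > 0"
    and sign: "s * p * T1 * (e1 * T1 + p) > 0" "s * p * T2 * (e2 * T2 + p) > 0"
      "s * p * T3 * (e3 * T3 + p) > 0"
  shows "realizable (2 * e1) (2 * e2) (2 * e3) T1 T2 T3"
proof -
  define W1 W2 W3 where W: "W1 = e1 * T1 + p" "W2 = e2 * T2 + p" "W3 = e3 * T3 + p"
  define a1 a2 a3 where a: "a1 = s * T1 / (2 * p * W1)" "a2 = s * T2 / (2 * p * W2)"
    "a3 = s * T3 / (2 * p * W3)"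
  have nz: "p \<noteq> 0" "W1 \<noteq> 0" "W2 \<noteq> 0" "W3 \<noteq> 0" "s \<noteq> 0"
    using sign by (auto simp: W)
  have pos: "s * T / (2 * p * V) > 0" if "s * p * T * V > 0" for T V
  proof -
    have "s * T / (2 * p * V) = (s * p * T * V) / (2 * (p * V)\<^sup>2)"
      using that by (simp add: field_simps power2_eq_square)
    also have "\<dots> > 0"
      using that by (intro divide_pos_pos) auto
    finally show ?thesis .
  qed
  have y: "2 * e1 * a1 = s / p - s / W1" "2 * e2 * a2 = s / p - s / W2" "2 * e3 * a3 = s / p - s / W3"
    using nz by (simp_all add: a field_simps) (simp_all add: W algebra_simps)
  \<comment> \<open>The cubic equation, in the form \<open>p / W1 + p / W2 + p / W3 = 1\<close> cleared of denominators.\<close>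
  have "p * (W2 * W3 + W1 * W3 + W1 * W2) = W1 * W2 * W3"
    using root by (simp add: ricci_cubic_def W power2_eq_square power3_eq_cube algebra_simps)
  note sigma = this
  then have "W2 * W3 + W1 * W3 + W1 * W2 \<noteq> 0"
    using nz by auto
  moreover have "s / W1 + s / W2 + s / W3 = s * (W2 * W3 + W1 * W3 + W1 * W2) / (W1 * W2 * W3)"
    using nz by (simp add: field_simps)
  ultimately have "s / W1 + s / W2 + s / W3 = s / p"
    unfolding sigma[symmetric] by simp
  then have Q: "2 * e2 * a2 + 2 * e3 * a3 - 2 * e1 * a1 = 2 * s / W1"
    "2 * e3 * a3 + 2 * e1 * a1 - 2 * e2 * a2 = 2 * s / W2"
    "2 * e1 * a1 + 2 * e2 * a2 - 2 * e3 * a3 = 2 * s / W3"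
    unfolding y by simp_all
  have s2: "s * s = 1" using s by auto
  define k where "k = s * p * (W1 * W2 * W3) / 2"
  have "(s * p * T1 * W1) * (s * p * T2 * W2) * (s * p * T3 * W3) > 0"
    using sign by (simp add: W)
  also have "(s * p * T1 * W1) * (s * p * T2 * W2) * (s * p * T3 * W3) =
      (T1 * T2 * T3 * p\<^sup>2 * (s * s)) * (2 * k)"
    by (simp add: k_def power2_eq_square)
  finally have "T1 * T2 * T3 * p\<^sup>2 * (s * s) * (2 * k) > 0" .
  moreover have "T1 * T2 * T3 * p\<^sup>2 * (s * s) > 0"
    unfolding s2 using prod nz by simp
  ultimately have "2 * k > 0" by (rule zero_less_mult_pos)
  then have "k > 0" by simp
  have Ts: "T1 = k * a1 * (2 * s / W2) * (2 * s / W3)" "T2 = k * a2 * (2 * s / W3) * (2 * s / W1)"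
    "T3 = k * a3 * (2 * s / W1) * (2 * s / W2)"
    using nz s by (auto simp: k_def a field_simps)
  show ?thesis
  proof (rule realizableI[of a1 a2 a3 k])
    show "a1 > 0" "a2 > 0" "a3 > 0"
      using sign pos by (simp_all add: a W)
    show "k > 0" by fact
  qed (simp_all only: Q Ts[symmetric])
qed

lemma ricci_cubic_at_neg:
  "ricci_cubic U1 U2 U3 (- U1) = - U1 * (U1 - U2) * (U1 - U3)"
  "ricci_cubic U1 U2 U3 (- U3) = - U3 * (U3 - U1) * (U3 - U2)"
  by (simp_all add: ricci_cubic_def power2_eq_square power3_eq_cube algebra_simps)

lemma root_strictly_between:
  fixes f :: "real \<Rightarrow> real"
  assumes "a < b" "continuous_on {a..b} f" "f a * f b < 0"
  obtains p where "a < p" "p < b" "f p = 0"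
proof -
  have "\<exists>p. a \<le> p \<and> p \<le> b \<and> f p = 0"
  proof (cases "f a < 0")
    case True
    then have "f b > 0" using assms(3) by (simp add: mult_less_0_iff)
    then show ?thesis
      using True assms(1,2) IVT'[of f a 0 b] by auto
  next
    case False
    then have "f b < 0" "f a > 0" using assms(3) by (auto simp: mult_less_0_iff)
    then show ?thesis
      using assms(1,2) IVT2'[of f b 0 a] by auto
  qed
  then obtain p where "a \<le> p" "p \<le> b" "f p = 0" by blast
  then show ?thesis
    using assms(3) that[of p] by (cases "p = a"; cases "p = b") auto
qed

section \<open>The group \<open>SO(3)\<close>\<close>

text \<open>
  All \<open>q\<^sub>i\<close> are positive if and only if all \<open>T\<^sub>i\<close> are; at most one can fail to be, and the ordering of the
  \<open>T\<^sub>i\<close> makes it \<open>q\<^sub>1\<close>.  If \<open>q\<^sub>1 < 0\<close>, then \<open>p = 2 k q\<^sub>1 q\<^sub>2 q\<^sub>3\<close> is a negative root of the cubic, and with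
  \<open>S = (T\<^sub>1 + T\<^sub>2 + T\<^sub>3) / 3\<close> the value at the critical point is \<open>(S - 2 p) (S + p)\<^sup>2 \<ge> 0\<close>.  Conversely, the
  intermediate value theorem provides a positive root when all \<open>T\<^sub>i\<close> are positive, and a negative root
  when \<open>T\<^sub>2, T\<^sub>3 < 0\<close>.
\<close>

lemma SO3_realizable_iff:
  assumes sorted: "T1 \<ge> T2" "T2 \<ge> T3"
  shows "realizable 2 2 2 T1 T2 T3 \<longleftrightarrow> SO3_constraint T1 T2 T3"
proof
  assume "realizable 2 2 2 T1 T2 T3"
  then obtain a1 a2 a3 k where a: "a1 > 0" "a2 > 0" "a3 > 0" "k > 0"
    and T0: "T1 = k * a1 * (2 * a3 + 2 * a1 - 2 * a2) * (2 * a1 + 2 * a2 - 2 * a3)"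
     "T2 = k * a2 * (2 * a1 + 2 * a2 - 2 * a3) * (2 * a2 + 2 * a3 - 2 * a1)"
     "T3 = k * a3 * (2 * a2 + 2 * a3 - 2 * a1) * (2 * a3 + 2 * a1 - 2 * a2)"
    unfolding realizable_iff by blast
  define q1 q2 q3 where q: "q1 = a2 + a3 - a1" "q2 = a3 + a1 - a2" "q3 = a1 + a2 - a3"
  have T: "T1 = 4 * k * a1 * (q2 * q3)" "T2 = 4 * k * a2 * (q3 * q1)" "T3 = 4 * k * a3 * (q1 * q2)"
    unfolding T0 q by (simp_all add: algebra_simps)
  have qsum: "q1 + q2 > 0" "q2 + q3 > 0" "q1 + q3 > 0"
    using a by (auto simp: q)
  have sgnT: "T1 > 0 \<longleftrightarrow> q2 * q3 > 0" "T2 > 0 \<longleftrightarrow> q3 * q1 > 0" "T3 > 0 \<longleftrightarrow> q1 * q2 > 0"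
    "T1 < 0 \<longleftrightarrow> q2 * q3 < 0" "T2 < 0 \<longleftrightarrow> q3 * q1 < 0" "T3 < 0 \<longleftrightarrow> q1 * q2 < 0"
    using a unfolding T by (simp_all only: zero_less_mult_iff mult_less_0_iff, auto)
  have q23: "q2 > 0 \<and> q3 > 0"
  proof (rule ccontr)
    assume "\<not> ?thesis"
    then consider "q2 \<le> 0" "q1 > 0" "q3 > 0" | "q3 \<le> 0" "q1 > 0" "q2 > 0"
      using qsum by linarith
    then show False
    proof cases
      case 1
      then have "T2 > 0" "\<not> T1 > 0" using sgnT by (auto simp: zero_less_mult_iff)
      then show False using sorted by simp
    next
      case 2
      then have "T3 > 0" "\<not> T1 > 0" using sgnT by (auto simp: zero_less_mult_iff)
      then show False using sorted by simp
    qed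
  qed
  then have T1: "T1 > 0" using sgnT by simp
  consider "q1 > 0" | "q1 = 0" | "q1 < 0" by linarith
  then show "SO3_constraint T1 T2 T3"
  proof cases
    case 1
    then show ?thesis using q23 sgnT sorted by (simp add: SO3_constraint_def)
  next
    case 2
    then show ?thesis using T1 sorted T by (simp add: SO3_constraint_def)
  next
    case 3
    then have neg: "T2 < 0" "T3 < 0"
      using sgnT q23 by (simp_all add: mult_pos_neg mult_neg_pos)
    define p where "p = 2 * k * (q1 * q2 * q3)"
    have p: "p < 0"
      using 3 q23 a by (simp add: p_def mult_pos_neg mult_neg_pos)
    have aq: "a1 = (q2 + q3) / 2" "a2 = (q1 + q3) / 2" "a3 = (q1 + q2) / 2"
      by (simp_all add: q)
    have root: "2 * p ^ 3 + (T1 + T2 + T3) * p\<^sup>2 - T1 * T2 * T3 = 0"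
      unfolding T p_def aq by (simp add: power2_eq_square power3_eq_cube field_simps)
    define S where "S = (T1 + T2 + T3) / 3"
    have S3: "T1 + T2 + T3 = 3 * S" by (simp add: S_def)
    have prod: "T1 * T2 * T3 = 2 * p ^ 3 + 3 * S * p\<^sup>2"
      using root unfolding S3 by simp
    have "T1 * T2 * T3 > 0"
      using T1 neg by (simp add: mult_pos_neg mult_neg_neg)
    moreover have "p ^ 3 < 0" using p by (simp add: power3_eq_cube mult_neg_neg mult_pos_neg)
    ultimately have "3 * S * p\<^sup>2 > 0" using prod by linarith
    then have S: "S > 0" using p by (simp add: zero_less_mult_iff)
    have "2 * (- S) ^ 3 + (3 * S) * (- S)\<^sup>2 - T1 * T2 * T3 = (S - 2 * p) * (S + p)\<^sup>2"
      unfolding prod by (simp add: power2_eq_square power3_eq_cube algebra_simps)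
    also have "\<dots> \<ge> 0" using S p by simp
    finally have "2 * (- S) ^ 3 + (3 * S) * (- S)\<^sup>2 - T1 * T2 * T3 \<ge> 0" .
    moreover have "- (T1 + T2 + T3) / 3 = - S"
      unfolding S_def by (rule minus_divide_left[symmetric])
    ultimately show ?thesis
      using S S3 T1 neg sorted by (simp only: SO3_constraint_def Let_def) auto
  qed
next
  let ?f = "ricci_cubic T1 T2 T3"
  assume "SO3_constraint T1 T2 T3"
  then consider "T1 > 0" "T2 > 0" "T3 > 0" | "T1 > 0" "T2 = 0" "T3 = 0"
    | "T1 > 0" "T2 < 0" "T3 < 0" "?f (- (T1 + T2 + T3) / 3) \<ge> 0" "- (T1 + T2 + T3) / 3 < 0"
    | "T1 > 0" "T2 < 0" "T3 < 0" "?f (- T1) > 0"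
    by (auto simp: SO3_constraint_def ricci_cubic_def Let_def)
  then show "realizable 2 2 2 T1 T2 T3"
  proof cases
    case 1
    \<comment> \<open>The cubic is negative at \<open>0\<close> and positive at the sum of the \<open>T\<^sub>i\<close>, since \<open>T\<^sub>1 T\<^sub>2 T\<^sub>3\<close> is at most its cube.\<close>
    define b where "b = T1 + T2 + T3"
    have "T1 * T2 * T3 \<le> b * b * b"
      using 1 by (intro mult_mono) (auto simp: b_def)
    moreover have "b * b * b > 0" "?f b = 3 * (b * b * b) - T1 * T2 * T3"
      using 1 by (auto simp: b_def[symmetric] ricci_cubic_def power2_eq_square power3_eq_cube)
        (simp add: b_def)
    ultimately have "?f b > 0" by linarith
    moreover have "?f 0 < 0" using 1 by (simp add: ricci_cubic_def)
    moreover have "0 < b" using 1 by (simp add: b_def)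
    ultimately obtain p where "0 < p" "?f p = 0"
      using root_strictly_between[OF _ continuous_on_ricci_cubic, of 0 b T1 T2 T3]
      by (metis mult_neg_pos)
    then show ?thesis
      using 1 ricci_cubic_root_realizable[of 1 1 1 1 T1 T2 T3 p] by simp
  next
    case 2
    \<comment> \<open>The degenerate case \<open>q\<^sub>1 = 0\<close>, that is, \<open>a\<^sub>1 = a\<^sub>2 + a\<^sub>3\<close>.\<close>
    then show ?thesis by (intro realizableI[of 2 1 1 "T1 / 32"]) auto
  next
    case 3
    define S where "S = (T1 + T2 + T3) / 3"
    have "- (T1 + T2 + T3) / 3 = - S"
      unfolding S_def by (rule minus_divide_left[symmetric])
    then have S: "S > 0" "?f (- S) \<ge> 0" using 3(4,5) by simp_all
    have prod: "T1 * T2 * T3 > 0" using 3 by (simp add: mult_pos_neg mult_neg_neg)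
    have "?f (- 2 * S) = - 4 * S ^ 3 - T1 * T2 * T3"
      by (simp add: ricci_cubic_def S_def power2_eq_square power3_eq_cube field_simps)
    also have "\<dots> < 0" using S(1) prod by (smt (verit) zero_less_power)
    finally obtain p where "p \<le> - S" "?f p = 0"
      using IVT'[of ?f "- 2 * S" 0 "- S"] S continuous_on_ricci_cubic by auto
    then have p: "p < 0" "?f p = 0" using S(1) by auto
    \<comment> \<open>Two rewritings of the cubic equation give \<open>p\<^sup>2 > T\<^sub>2 T\<^sub>3\<close> and then \<open>T\<^sub>1 + p > 0\<close>, the sign condition for \<open>a\<^sub>1\<close>.\<close>
    have "T1 * (T2 * T3 - p * p) = p * p * (2 * p + T2 + T3)"
      using p(2) by (simp add: ricci_cubic_def power2_eq_square power3_eq_cube algebra_simps)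
    also have "\<dots> < 0"
      using 3 p by (intro mult_pos_neg) (auto simp: mult_neg_neg)
    finally have "T2 * T3 - p * p < 0"
      using 3(1) by (simp add: mult_less_0_iff)
    moreover have "(T1 + p) * (T2 * T3 - p * p) = p * ((T2 + p) * (T3 + p))"
      using p(2) by (simp add: ricci_cubic_def power2_eq_square power3_eq_cube algebra_simps)
    moreover have "p * ((T2 + p) * (T3 + p)) < 0"
      using 3 p by (intro mult_neg_pos mult_neg_neg) auto
    ultimately have "T1 + p > 0"
      by (metis mult_less_0_iff order_less_asym)
    then show ?thesis
      using 3 p prod ricci_cubic_root_realizable[of 1 1 1 "-1" T1 T2 T3 p]
      by (simp add: mult_pos_neg mult_neg_neg mult_neg_pos)
  next
    case 4
    have "T1 * (T1 - T2) * (T1 - T3) > 0" using 4 by simp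
    then show ?thesis using 4(4) by (simp add: ricci_cubic_at_neg)
  qed
qed

section \<open>The group \<open>SL(2)\<close>\<close>

text \<open>
  With \<open>s = a\<^sub>1 + a\<^sub>2 + a\<^sub>3\<close>, \<open>p = a\<^sub>1 - a\<^sub>2 - a\<^sub>3\<close>, \<open>q = a\<^sub>2 - a\<^sub>1 - a\<^sub>3\<close> and \<open>r = a\<^sub>1 + a\<^sub>2 - a\<^sub>3\<close> the \<open>T\<^sub>i\<close> are
  positive multiples of \<open>p\<close>, \<open>q\<close>, \<open>p q\<close>, and \<open>T\<^sub>1 + T\<^sub>3\<close>, \<open>T\<^sub>2 + T\<^sub>3\<close> are positive multiples of \<open>p r\<close> and
  \<open>q r\<close>.  Since \<open>p + q < 0\<close>, the sign patterns of \<open>p\<close>, \<open>q\<close>, \<open>r\<close> correspond to the alternatives of the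
  constraint.
\<close>

lemma SL2_constraint_if_realizable:
  assumes "realizable 2 2 (- 2) T1 T2 T3"
  shows "SL2_constraint T1 T2 T3"
proof -
  obtain a1 a2 a3 k where a: "a1 > 0" "a2 > 0" "a3 > 0" "k > 0"
    and T0: "T1 = k * a1 * (- 2 * a3 + 2 * a1 - 2 * a2) * (2 * a1 + 2 * a2 - (- 2) * a3)"
     "T2 = k * a2 * (2 * a1 + 2 * a2 - (- 2) * a3) * (2 * a2 + (- 2) * a3 - 2 * a1)"
     "T3 = k * a3 * (2 * a2 + (- 2) * a3 - 2 * a1) * ((- 2) * a3 + 2 * a1 - 2 * a2)"
    using assms unfolding realizable_iff by blast
  define p q s where d: "p = a1 - a2 - a3" "q = a2 - a1 - a3" "s = a1 + a2 + a3"
  define r where "r = a1 + a2 - a3"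
  have T: "T1 = 4 * k * a1 * s * p" "T2 = 4 * k * a2 * s * q" "T3 = 4 * k * a3 * (p * q)"
    unfolding T0 d by (simp_all add: algebra_simps)
  have sum: "T1 + T3 = 4 * k * (a1 + a3) * (p * r)" "T2 + T3 = 4 * k * (a2 + a3) * (q * r)"
    unfolding T d r_def by (simp_all add: algebra_simps)
  have s: "s > 0" using a by (simp add: d)
  have sg: "c * x > 0 \<longleftrightarrow> x > 0" "c * x < 0 \<longleftrightarrow> x < 0" if "c > 0" for c x :: real
    using that by (simp_all add: zero_less_mult_iff mult_less_0_iff)
  have c: "4 * k * a1 * s > 0" "4 * k * a2 * s > 0" "4 * k * a3 > 0"
    "4 * k * (a1 + a3) > 0" "4 * k * (a2 + a3) > 0"
    using a s by simp_all
  have sgnT: "T1 > 0 \<longleftrightarrow> p > 0" "T2 > 0 \<longleftrightarrow> q > 0" "T3 > 0 \<longleftrightarrow> p * q > 0"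
    "T1 < 0 \<longleftrightarrow> p < 0" "T2 < 0 \<longleftrightarrow> q < 0" "T3 < 0 \<longleftrightarrow> p * q < 0"
    by (simp_all only: T sg[OF c(1)] sg[OF c(2)] sg[OF c(3)])
  have sgnT': "T1 + T3 > 0 \<longleftrightarrow> p * r > 0" "T2 + T3 > 0 \<longleftrightarrow> q * r > 0"
    "T1 + T3 < 0 \<longleftrightarrow> p * r < 0" "T2 + T3 < 0 \<longleftrightarrow> q * r < 0"
    by (simp_all only: sum sg[OF c(4)] sg[OF c(5)])
  have zero: "p = 0 \<Longrightarrow> T1 = 0 \<and> T3 = 0" "q = 0 \<Longrightarrow> T2 = 0 \<and> T3 = 0"
    by (simp_all add: T)
  have pq: "p + q < 0" using a by (simp add: d)
  have "p > 0 \<and> q < 0 \<and> r > 0 \<or> q > 0 \<and> p < 0 \<and> r > 0 \<or> p = 0 \<and> q < 0 \<or> q = 0 \<and> p < 0 \<or>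
      p < 0 \<and> q < 0"
    using a unfolding d r_def by linarith
  then consider "p > 0" "q < 0" "r > 0" | "q > 0" "p < 0" "r > 0" | "p = 0" "q < 0" | "q = 0" "p < 0"
    | "p < 0" "q < 0" "r > 0" | "p < 0" "q < 0" "r = 0" | "p < 0" "q < 0" "r < 0"
    by (metis linorder_neqE_linordered_idom)
  then show ?thesis
  proof cases
    case 1
    then have "T1 > 0" "T2 < 0" "T3 < 0" "T3 + T1 > 0"
      using sgnT sgnT' by (simp_all add: mult_pos_neg add.commute)
    then show ?thesis by (simp add: SL2_constraint_def)
  next
    case 2
    then have "T2 > 0" "T1 < 0" "T3 < 0" "T3 + T2 > 0"
      using sgnT sgnT' by (simp_all add: mult_neg_pos add.commute)
    then show ?thesis by (simp add: SL2_constraint_def)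
  next
    case 3
    then show ?thesis using sgnT zero by (simp add: SL2_constraint_def)
  next
    case 4
    then show ?thesis using sgnT zero by (simp add: SL2_constraint_def)
  next
    case 5
    then have "T1 < 0" "T2 < 0" "T3 > 0" "T1 + T3 < 0" "T2 + T3 < 0"
      using sgnT sgnT' by (simp_all add: mult_neg_pos mult_neg_neg)
    then show ?thesis by (simp add: SL2_constraint_def)
  next
    case 6
    then have "T1 < 0" "T2 < 0" "T3 > 0"
      using sgnT by (simp_all add: mult_neg_neg)
    moreover have "T3 = - T1" "T3 = - T2"
      using 6 sum by (simp_all add: add_eq_0_iff)
    ultimately show ?thesis by (simp add: SL2_constraint_def)
  next
    case 7
    then have "T1 < 0" "T2 < 0" "T3 > 0" "T1 + T3 > 0" "T2 + T3 > 0"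
      using sgnT sgnT' by (simp_all add: mult_neg_neg)
    then show ?thesis by (simp add: SL2_constraint_def)
  qed
qed

lemma SL2_root_realizable:
  assumes s: "s \<in> {1, - 1}" and root: "ricci_cubic T1 T2 (- T3) p = 0" and prod: "T1 * T2 * T3 > 0"
    and sign: "s * p * T1 * (T1 + p) > 0" "s * p * T2 * (T2 + p) > 0" "s * p * T3 * (p - T3) > 0"
  shows "realizable 2 2 (- 2) T1 T2 T3"
  using ricci_cubic_root_realizable[of 1 1 "-1" s T1 T2 T3 p] assms by simp

text \<open>
  The condition on the sum makes \<open>(- T\<^sub>1, T\<^sub>3)\<close> a nonempty interval, at whose ends the cubic for
  \<open>U = (T\<^sub>1, T\<^sub>2, - T\<^sub>3)\<close> has opposite signs; every root in it satisfies the sign conditions.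
\<close>

lemma SL2_mixed_realizable:
  assumes T: "T1 > 0" "T2 < 0" "T3 < 0" "T3 + T1 > 0"
  shows "realizable 2 2 (- 2) T1 T2 T3"
proof -
  let ?f = "ricci_cubic T1 T2 (- T3)"
  have "T1 * (T1 - T2) * (T1 + T3) > 0" using T by simp
  then have left: "?f (- T1) < 0"
    using ricci_cubic_at_neg(1)[of T1 T2 "- T3"] by simp
  have "T3 * (- T3 - T1) * (- T3 - T2) > 0"
    by (rule mult_pos_pos[OF mult_neg_neg]) (use T in auto)
  then have right: "?f T3 > 0"
    using ricci_cubic_at_neg(2)[of T1 T2 "- T3"] by simp
  have "- T1 < T3" using T by linarith
  from root_strictly_between[OF this continuous_on_ricci_cubic mult_neg_pos[OF left right]]
  obtain p where p: "- T1 < p" "p < T3" "?f p = 0" .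
  show ?thesis
    using p T by (intro SL2_root_realizable[of "-1" T1 T2 T3 p])
      (auto simp: mult_pos_neg mult_neg_neg mult_neg_pos)
qed

text \<open>
  The cubic for \<open>U = (T\<^sub>1, T\<^sub>2, - T\<^sub>3)\<close> is positive at \<open>T\<^sub>3\<close>.  At \<open>- T\<^sub>1\<close> it is negative if \<open>T\<^sub>1 \<noteq> T\<^sub>2\<close>, by the
  second order hypothesis, which says that \<open>- T\<^sub>1\<close> is the nearer of \<open>- T\<^sub>1\<close> and \<open>- T\<^sub>2\<close> to \<open>T\<^sub>3\<close> when both
  are larger than \<open>T\<^sub>3\<close>, and likewise when both are smaller.  If \<open>T\<^sub>1 = T\<^sub>2\<close>, then \<open>- T\<^sub>1\<close> is itself a root,
  at which \<open>U\<^sub>1 + p = 0\<close>; the required root is one of the quadratic cofactor.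
\<close>

lemma SL2_definite_root:
  assumes T: "T1 < 0" "T2 < 0" "T3 > 0" "T1 \<noteq> - T3"
    and order: "(T1 + T3) * (T2 + T3) > 0" "(T2 - T1) * (T1 + T3) \<ge> 0"
  obtains p where "ricci_cubic T1 T2 (- T3) p = 0"
    "min (- T1) T3 < p" "p < max (- T1) T3"
proof -
  let ?f = "ricci_cubic T1 T2 (- T3)"
  show thesis
  proof (cases "T1 = T2")
    case False
    have cont: "continuous_on A ?f" for A by (rule continuous_on_ricci_cubic)
    have "(T2 - T1) * (T1 + T3) > 0" using order(2) T(4) False by (simp add: order_less_le)
    then have "- T1 * ((T2 - T1) * (T1 + T3)) > 0" using T(1) by (simp add: mult_neg_pos)
    then have l: "?f (- T1) < 0"
      using ricci_cubic_at_neg(1)[of T1 T2 "- T3"] by (simp add: algebra_simps)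
    have "T3 * ((T1 + T3) * (T2 + T3)) > 0" using order(1) T(3) by simp
    then have r: "?f T3 > 0"
      using ricci_cubic_at_neg(2)[of T1 T2 "- T3"] by (simp add: algebra_simps)
    consider "- T1 < T3" | "T3 < - T1" using T(4) by linarith
    then show thesis
    proof cases
      case 1
      show thesis
        by (rule root_strictly_between[OF 1 cont mult_neg_pos[OF l r]]) (use 1 that in auto)
    next
      case 2
      show thesis
        by (rule root_strictly_between[OF 2 cont mult_pos_neg[OF r l]]) (use 2 that in auto)
    qed
  next
    case True
    let ?h = "\<lambda>p. 2 * p\<^sup>2 - T3 * p + T1 * T3"
    have f: "?f p = (p + T1) * ?h p" for p
      using True by (simp add: ricci_cubic_def power2_eq_square power3_eq_cube algebra_simps)
    have h: "?h (- T1) = 2 * T1 * (T1 + T3)" "?h T3 = T3 * (T1 + T3)"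
      by (simp_all add: power2_eq_square algebra_simps)
    have "(T1 * T3) * ((T1 + T3) * (T1 + T3)) < 0"
      using T by (intro mult_neg_pos) (auto simp: mult_neg_pos zero_less_mult_iff)
    then have m: "?h (- T1) * ?h T3 < 0" "?h T3 * ?h (- T1) < 0"
      unfolding h by (simp_all add: algebra_simps)
    have cont: "continuous_on A ?h" for A by (intro continuous_intros)
    consider "- T1 < T3" | "T3 < - T1" using T(4) by linarith
    then show thesis
    proof cases
      case 1
      show thesis
        by (rule root_strictly_between[OF 1 cont m(1)]) (use 1 that f in auto)
    next
      case 2
      show thesis
        by (rule root_strictly_between[OF 2 cont m(2)]) (use 2 that f in auto)
    qed
  qed
qed

text \<open>
  The hypothesis says that \<open>- T\<^sub>1\<close> and \<open>- T\<^sub>2\<close> lie strictly on the same side of \<open>T\<^sub>3\<close>.  Exchanging the first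
  two basis vectors if necessary, \<open>SL2_definite_root\<close> yields a root between \<open>T\<^sub>3\<close> and both of them.
\<close>

lemma SL2_definite_realizable:
  assumes T: "T1 < 0" "T2 < 0" "T3 > 0" and order: "(T1 + T3) * (T2 + T3) > 0"
  shows "realizable 2 2 (- 2) T1 T2 T3"
proof -
  have main: "realizable 2 2 (- 2) T1 T2 T3"
    if T: "T1 < 0" "T2 < 0" "T3 > 0" and order: "(T1 + T3) * (T2 + T3) > 0" "(T2 - T1) * (T1 + T3) \<ge> 0"
    for T1 T2 T3
  proof -
    have ne: "T1 + T3 \<noteq> 0" using order(1) by auto
    then have "T1 \<noteq> - T3" by linarith
    then obtain p where p: "ricci_cubic T1 T2 (- T3) p = 0" "min (- T1) T3 < p" "p < max (- T1) T3"
      using SL2_definite_root[OF T _ order] by blast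
    have prod: "T1 * T2 * T3 > 0" using T by (simp add: mult_neg_neg)
    consider "T1 + T3 > 0" "T1 \<le> T2" | "T1 + T3 < 0" "T2 \<le> T1"
      using ne order(2) by (auto simp: zero_le_mult_iff)
    then show ?thesis
    proof cases
      case 1
      then have "- T1 < p" "p < T3" "- T2 < p" using p by auto
      then show ?thesis
        using T p(1) prod by (intro SL2_root_realizable[of "-1" T1 T2 T3 p])
          (auto simp: mult_pos_neg mult_neg_neg mult_neg_pos)
    next
      case 2
      then have "p < - T1" "T3 < p" "p < - T2" using p by auto
      then show ?thesis
        using T p(1) prod by (intro SL2_root_realizable[of 1 T1 T2 T3 p])
          (auto simp: mult_pos_neg mult_neg_neg mult_neg_pos)
    qed
  qed
  have "(T2 - T1) * (T1 + T3) \<ge> 0 \<or> (T1 - T2) * (T2 + T3) \<ge> 0"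
  proof (cases "T1 + T3 > 0")
    case True
    then have "T2 + T3 > 0" using order by (simp add: zero_less_mult_iff)
    then show ?thesis using True by (cases "T1 \<le> T2") auto
  next
    case False
    then have "T1 + T3 \<le> 0" "T2 + T3 \<le> 0" using order by (auto simp: zero_less_mult_iff)
    then show ?thesis by (cases "T1 \<le> T2") (auto intro: mult_nonpos_nonpos)
  qed
  then consider "(T2 - T1) * (T1 + T3) \<ge> 0" | "(T1 - T2) * (T2 + T3) \<ge> 0"
    by blast
  then show ?thesis
  proof cases
    case 1
    then show ?thesis using main T order by blast
  next
    case 2
    then have "realizable 2 2 (- 2) T2 T1 T3"
      using main[of T2 T1 T3] T order by (simp add: mult.commute)
    then show ?thesis by (rule realizable_swap12)
  qed
qed

lemma SL2_realizable_iff: "realizable 2 2 (- 2) T1 T2 T3 \<longleftrightarrow> SL2_constraint T1 T2 T3"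
proof
  assume "SL2_constraint T1 T2 T3"
  then show "realizable 2 2 (- 2) T1 T2 T3"
    unfolding SL2_constraint_def
  proof (elim disjE conjE)
    assume "T1 > 0" "T2 < 0" "T3 < 0" "T3 + T1 > 0"
    then show ?thesis by (rule SL2_mixed_realizable)
  next
    assume "T2 > 0" "T1 < 0" "T3 < 0" "T3 + T2 > 0"
    then show ?thesis by (rule realizable_swap12[OF SL2_mixed_realizable])
  next
    assume "T1 < 0" "T2 < 0" "0 < T3" "max (- T1) (- T2) < T3"
    then show ?thesis by (intro SL2_definite_realizable mult_pos_pos) auto
  next
    assume "T1 < 0" "T2 < 0" "0 < T3" "T3 < min (- T1) (- T2)"
    then show ?thesis by (intro SL2_definite_realizable mult_neg_neg) auto
  next
    assume "0 < T3" "T3 = - T1" "T3 = - T2"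
    \<comment> \<open>The case \<open>r = 0\<close>, that is, \<open>a\<^sub>3 = a\<^sub>1 + a\<^sub>2\<close>.\<close>
    then show ?thesis by (intro realizableI[of 1 1 2 "T3 / 32"]) auto
  next
    assume "T1 < 0" "T2 = 0" "T3 = 0"
    \<comment> \<open>The case \<open>q = 0\<close>, that is, \<open>a\<^sub>2 = a\<^sub>1 + a\<^sub>3\<close>.\<close>
    then show ?thesis by (intro realizableI[of 1 2 1 "- T1 / 32"]) auto
  next
    assume "T2 < 0" "T1 = 0" "T3 = 0"
    \<comment> \<open>The case \<open>p = 0\<close>, that is, \<open>a\<^sub>1 = a\<^sub>2 + a\<^sub>3\<close>.\<close>
    then show ?thesis by (intro realizableI[of 2 1 1 "- T2 / 32"]) auto
  qed
qed (rule SL2_constraint_if_realizable)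

section \<open>Prescribed Ricci curvature on unimodular groups\<close>

text \<open>
  Exchanging two basis vectors reverses the orientation and thereby the signs of the structure constants;
  negating all three vectors restores them.
\<close>

lemma milnor_basis_transpose:
  assumes br: "lie_bracket br" and V: "milnor_basis br l V" and ij: "i \<noteq> j" and l: "l $ i = l $ j"
  shows "milnor_basis br l (\<lambda>k. - V (Transposition.transpose i j k))"
proof -
  have eq: "br (V i) (V j) = (\<Sum>k\<in>UNIV. (levi_civita_symbol i j k * l $ k) *\<^sub>R V k)" for i j
    using V by (simp add: milnor_basis_def)
  have bil: "bilinear br"
    using br by (simp add: lie_bracket_def)
  have "is_basis (\<lambda>k. - 1 *\<^sub>R V (Transposition.transpose i j k))"
    using V by (intro is_basis_permute_scale permutes_swap_id) (auto simp: milnor_basis_def)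
  then have "is_basis (\<lambda>k. - V (Transposition.transpose i j k))"
    by simp
  then show ?thesis
    unfolding milnor_basis_iff[OF br]
    using exhaust_3[of i] exhaust_3[of j] ij l
    by (auto simp: bilinear_lneg[OF bil] bilinear_rneg[OF bil] eq sum_3 levi_civita_symbol_def Transposition.transpose_def)
qed

lemma sorted_if_swap_closed:
  fixes P :: "'a::linorder \<Rightarrow> 'a \<Rightarrow> 'a \<Rightarrow> bool"
  assumes "P a b c" and s12: "\<And>a b c. P a b c \<Longrightarrow> P b a c" and s23: "\<And>a b c. P a b c \<Longrightarrow> P a c b"
  shows "\<exists>a b c. P a b c \<and> a \<ge> b \<and> b \<ge> c"
proof -
  have perms: "P a b c" "P b a c" "P a c b" "P b c a" "P c a b" "P c b a"
    using assms by blast+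
  then show ?thesis
    by (metis linear)
qed

text \<open>
  If the structure constants agree, the basis vectors may be permuted freely, which allows the ordering
  convention in the constraint for \<open>SO(3)\<close> to be met.
\<close>

lemma sorted_milnor_basis:
  assumes br: "lie_bracket br" and V: "milnor_basis br (vector [r, r, r]) V"
    and diag: "\<And>i j. i \<noteq> j \<Longrightarrow> T (V i) (V j) = 0" and T: "bilinear T"
    and real: "realizable r r r (T (V 1) (V 1)) (T (V 2) (V 2)) (T (V 3) (V 3))"
  obtains U where "milnor_basis br (vector [r, r, r]) U" "\<And>i j. i \<noteq> j \<Longrightarrow> T (U i) (U j) = 0"
    "realizable r r r (T (U 1) (U 1)) (T (U 2) (U 2)) (T (U 3) (U 3))"
    "T (U 1) (U 1) \<ge> T (U 2) (U 2)" "T (U 2) (U 2) \<ge> T (U 3) (U 3)"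
proof -
  let ?l = "vector [r, r, r] :: real ^ 3"
  define P where "P t1 t2 t3 \<longleftrightarrow> realizable r r r t1 t2 t3 \<and> (\<exists>U. milnor_basis br ?l U \<and>
    (\<forall>i j. i \<noteq> j \<longrightarrow> T (U i) (U j) = 0) \<and> t1 = T (U 1) (U 1) \<and> t2 = T (U 2) (U 2) \<and> t3 = T (U 3) (U 3))" for t1 t2 t3
  have swap: "\<exists>U'. milnor_basis br ?l U' \<and> (\<forall>i j. i \<noteq> j \<longrightarrow> T (U' i) (U' j) = 0) \<and>
      (\<forall>i. T (U' i) (U' i) = T (U (Transposition.transpose m n i)) (U (Transposition.transpose m n i)))"
    if U: "milnor_basis br ?l U" "\<forall>i j. i \<noteq> j \<longrightarrow> T (U i) (U j) = 0" and "m \<noteq> n" for U m n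
  proof (intro exI conjI allI impI)
    have "?l $ m = ?l $ n"
      using exhaust_3[of m] exhaust_3[of n] by auto
    then show "milnor_basis br ?l (\<lambda>k. - U (Transposition.transpose m n k))"
      using U(1) \<open>m \<noteq> n\<close> by (intro milnor_basis_transpose[OF br])
    show "T (- U (Transposition.transpose m n i)) (- U (Transposition.transpose m n j)) = 0" if "i \<noteq> j" for i j
    proof -
      have "Transposition.transpose m n i \<noteq> Transposition.transpose m n j"
        using that by (auto simp: Transposition.transpose_def split: if_splits)
      then show ?thesis
        using U(2) by (simp add: bilinear_lneg[OF T] bilinear_rneg[OF T])
    qed
    show "T (- U (Transposition.transpose m n i)) (- U (Transposition.transpose m n i)) = T (U (Transposition.transpose m n i)) (U (Transposition.transpose m n i))" for i
      by (simp add: bilinear_lneg[OF T] bilinear_rneg[OF T])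
  qed
  have "P (T (V 1) (V 1)) (T (V 2) (V 2)) (T (V 3) (V 3))"
    unfolding P_def using V diag real by blast
  moreover have "P t2 t1 t3" if P: "P t1 t2 t3" for t1 t2 t3
  proof -
    obtain U where U: "milnor_basis br ?l U" "\<forall>i j. i \<noteq> j \<longrightarrow> T (U i) (U j) = 0"
      "t1 = T (U 1) (U 1)" "t2 = T (U 2) (U 2)" "t3 = T (U 3) (U 3)"
      using P unfolding P_def by blast
    have "realizable r r r t2 t1 t3"
      using P realizable_swap12 unfolding P_def by blast
    moreover obtain U' where U': "milnor_basis br ?l U'" "\<forall>i j. i \<noteq> j \<longrightarrow> T (U' i) (U' j) = 0"
      "\<forall>i. T (U' i) (U' i) = T (U (Transposition.transpose 1 2 i)) (U (Transposition.transpose 1 2 i))"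
      using swap[OF U(1,2), of 1 2] by auto
    moreover have "t2 = T (U' 1) (U' 1)" "t1 = T (U' 2) (U' 2)" "t3 = T (U' 3) (U' 3)"
      using U(3-5) U'(3) by (simp_all add: Transposition.transpose_def)
    ultimately show ?thesis unfolding P_def by blast
  qed
  moreover have "P t1 t3 t2" if P: "P t1 t2 t3" for t1 t2 t3
  proof -
    obtain U where U: "milnor_basis br ?l U" "\<forall>i j. i \<noteq> j \<longrightarrow> T (U i) (U j) = 0"
      "t1 = T (U 1) (U 1)" "t2 = T (U 2) (U 2)" "t3 = T (U 3) (U 3)"
      using P unfolding P_def by blast
    have "realizable r r r t1 t3 t2"
      using P realizable_swap23 unfolding P_def by blast
    moreover obtain U' where U': "milnor_basis br ?l U'" "\<forall>i j. i \<noteq> j \<longrightarrow> T (U' i) (U' j) = 0"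
      "\<forall>i. T (U' i) (U' i) = T (U (Transposition.transpose 2 3 i)) (U (Transposition.transpose 2 3 i))"
      using swap[OF U(1,2), of 2 3] by auto
    moreover have "t1 = T (U' 1) (U' 1)" "t3 = T (U' 2) (U' 2)" "t2 = T (U' 3) (U' 3)"
      using U(3-5) U'(3) by (simp_all add: Transposition.transpose_def)
    ultimately show ?thesis unfolding P_def by blast
  qed
  ultimately have "\<exists>a b c. P a b c \<and> a \<ge> b \<and> b \<ge> c"
    by (rule sorted_if_swap_closed)
  then show thesis
    using that unfolding P_def by blast
qed

theorem theorem2p1:
  fixes br :: "'a::real_vector \<Rightarrow> 'a \<Rightarrow> 'a"
    and l :: "real ^ 3"
    and T :: "'a \<Rightarrow> 'a \<Rightarrow> real"
  assumes "dim (UNIV :: 'a set) = 3"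
    and "lie_bracket br"
    and "unimodular br"
    and "normalized_structure_constants br l"
    and "bilinear T"
  shows "(\<exists>g c. riemannian_metric g \<and> c > 0 \<and> (\<forall>x y. ricci br g x y = c * T x y)) \<longleftrightarrow>
    (\<exists>V. milnor_basis br l V \<and> (\<forall>i j. i \<noteq> j \<longrightarrow> T (V i) (V j) = 0) \<and>
       (let T1 = T (V 1) (V 1); T2 = T (V 2) (V 2); T3 = T (V 3) (V 3) in
          (l = vector [2, 2, 2] \<longrightarrow> SO3_constraint T1 T2 T3) \<and>
          (l = vector [2, 2, - 2] \<longrightarrow> SL2_constraint T1 T2 T3) \<and>
          (l = vector [2, 2, 0] \<longrightarrow> E2_constraint T1 T2 T3) \<and>
          (l = vector [2, - 2, 0] \<longrightarrow> E11_constraint T1 T2 T3) \<and>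
          (l = vector [2, 0, 0] \<longrightarrow> H3_constraint T1 T2 T3) \<and>
          (l = vector [0, 0, 0] \<longrightarrow> R3_constraint T1 T2 T3)))"
    (is "?lhs \<longleftrightarrow> (\<exists>V. ?diag V \<and> ?orth V \<and> ?constraints V)")
proof -
  have l: "l \<in> {vector [2, 2, 2], vector [2, 2, - 2], vector [2, 2, 0],
      vector [2, - 2, 0], vector [2, 0, 0], vector [0, 0, 0]}"
    using assms(4) by (simp add: normalized_structure_constants_def)
  obtain V0 where V0: "milnor_basis br l V0"
    using assms(4) by (auto simp: normalized_structure_constants_def)
  let ?real = "\<lambda>V. realizable (l $ 1) (l $ 2) (l $ 3) (T (V 1) (V 1)) (T (V 2) (V 2)) (T (V 3) (V 3))"
  have vec: "vector [x1, x2, x3] = (vector [y1, y2, y3] :: real ^ 3) \<longleftrightarrow> x1 = y1 \<and> x2 = y2 \<and> x3 = y3"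
    for x1 x2 x3 y1 y2 y3
    by (simp add: vec_eq_iff forall_3)
  have "?lhs \<longleftrightarrow> (\<exists>V. ?diag V \<and> ?orth V \<and> ?real V)"
    by (rule prescribed_ricci_iff_realizable[OF assms(1,2) V0 assms(5)])
  also have "\<dots> \<longleftrightarrow> (\<exists>V. ?diag V \<and> ?orth V \<and> ?constraints V)"
  proof (cases "l = vector [2, 2, 2]")
    case False
    have "?real V \<longleftrightarrow> ?constraints V" for V
      using l False
      by (auto simp: vec Let_def SL2_realizable_iff E2_realizable_iff E11_realizable_iff
          H3_realizable_iff R3_realizable_iff)
    then show ?thesis by simp
  next
    case True
    have constraints: "?constraints V \<longleftrightarrow> SO3_constraint (T (V 1) (V 1)) (T (V 2) (V 2)) (T (V 3) (V 3))" for V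
      by (simp add: True vec Let_def)
    show ?thesis
    proof
      assume "\<exists>V. ?diag V \<and> ?orth V \<and> ?real V"
      then obtain V where V: "milnor_basis br (vector [2, 2, 2]) V"
        "\<And>i j. i \<noteq> j \<Longrightarrow> T (V i) (V j) = 0"
        "realizable 2 2 2 (T (V 1) (V 1)) (T (V 2) (V 2)) (T (V 3) (V 3))"
        unfolding True by auto
      obtain U where U: "milnor_basis br (vector [2, 2, 2]) U" "\<And>i j. i \<noteq> j \<Longrightarrow> T (U i) (U j) = 0"
        "realizable 2 2 2 (T (U 1) (U 1)) (T (U 2) (U 2)) (T (U 3) (U 3))"
        "T (U 1) (U 1) \<ge> T (U 2) (U 2)" "T (U 2) (U 2) \<ge> T (U 3) (U 3)"
        using sorted_milnor_basis[OF assms(2) V(1,2) assms(5) V(3)] by blast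
      have "SO3_constraint (T (U 1) (U 1)) (T (U 2) (U 2)) (T (U 3) (U 3))"
        using U(3) SO3_realizable_iff[OF U(4,5)] by simp
      then show "\<exists>V. ?diag V \<and> ?orth V \<and> ?constraints V"
        unfolding constraints using U(1,2) True by blast
    next
      assume "\<exists>V. ?diag V \<and> ?orth V \<and> ?constraints V"
      then obtain V where V: "?diag V" "?orth V" "SO3_constraint (T (V 1) (V 1)) (T (V 2) (V 2)) (T (V 3) (V 3))"
        unfolding constraints by blast
      then have "T (V 1) (V 1) \<ge> T (V 2) (V 2)" "T (V 2) (V 2) \<ge> T (V 3) (V 3)"
        by (auto simp: SO3_constraint_def)
      from SO3_realizable_iff[OF this] V(3) have "?real V"
        by (simp add: True)
      then show "\<exists>V. ?diag V \<and> ?orth V \<and> ?real V"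
        using V(1,2) by blast
    qed
  qed
  finally show ?thesis .
qed

end
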